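(* There is an absolute constant $K>0$ such that the following holds. Let $d\geq 4$ be even, and let $m\geq 3$ be such that $7\nmid dm$. Put $n=dm$ and $G=\mathrm{SL}_n(8)=\mathrm{PSL}_n(8)$. There is a monic irreducible polynomial $p\in\mathbb{F}_8[T]$ of degree $d$ such that $C(p)^{\oplus m}\in G$ and the conjugacy class $S$ of $C(p)^{\oplus m}$ in $G$ is real (that is, $S=S^{-1}$) and satisfies $$\left|\frac{\log|S|}{\log|G|}-\Bigl(1-\frac1d\Bigr)\right|\leq Kn^{-2},$$ while for every integer $s$ with $2\leq s<m$ there is an element $x_s\in G$ such that $\operatorname{supp}(x_s)=s$ and $x_s\notin SS^{-1}$, where $SS^{-1}=\{ab^{-1}:a,b\in S\}$.
   Context: $C(f)$ denotes the companion matrix of a monic polynomial $f$, and $C(p)^{\oplus m}$ is the block-diagonal matrix with $m$ copies of $C(p)$. For $g\in\mathrm{GL}_n(q)$, the support is $\operatorname{supp}(g):=\min_{\lambda\in\overline{\mathbb{F}}_q^{\times}}\operatorname{rank}(g-\lambda I)$. Since $7\nmid n$, the center of $\mathrm{SL}_n(8)$ is trivial, so $\mathrm{SL}_n(8)=\mathrm{PSL}_n(8)$. *)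

theory Defs
  imports
    Complex_Main
    "HOL-Algebra.Coset"
    "HOL-Algebra.Algebraic_Closure_Type"
    "Jordan_Normal_Form.Determinant"
    "Jordan_Normal_Form.DL_Rank"
begin

definition SL :: "nat \<Rightarrow> 'a :: field mat monoid" where
  "SL n = \<lparr>carrier = {A \<in> carrier_mat n n. det A = 1}, monoid.mult = (*), one = 1\<^sub>m n\<rparr>"

lemma SL_simps [simp]:
  "carrier (SL n) = {A \<in> carrier_mat n n. det A = 1}"
  "monoid.mult (SL n) = (*)"
  "\<one>\<^bsub>SL n\<^esub> = 1\<^sub>m n"
  by (simp_all add: SL_def)

lemma group_SL: "group (SL n :: 'a :: field mat monoid)"
proof (rule groupI)
  fix A :: "'a mat" assume "A \<in> carrier (SL n)"
  then have A: "A \<in> carrier_mat n n" "det A = 1" by simp_all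
  have eq: "adj_mat A * A = 1\<^sub>m n"
    using adj_mat(3)[OF A(1)] A(2) by (auto intro: eq_matI)
  have "det (adj_mat A) * det A = det (adj_mat A * A)"
    using det_mult[OF adj_mat(1)[OF A(1)] A(1)] by simp
  then have "det (adj_mat A) = 1" using A(2) eq by simp
  then show "\<exists>B \<in> carrier (SL n). B \<otimes>\<^bsub>SL n\<^esub> A = \<one>\<^bsub>SL n\<^esub>"
    using eq adj_mat(1)[OF A(1)] by auto
qed (auto simp: det_mult assoc_mult_mat)

definition conj_class :: "('g, 'b) monoid_scheme \<Rightarrow> 'g \<Rightarrow> 'g set" where
  "conj_class G x = {h \<otimes>\<^bsub>G\<^esub> x \<otimes>\<^bsub>G\<^esub> inv\<^bsub>G\<^esub> h | h. h \<in> carrier G}"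

text \<open>Ones on the subdiagonal, and minus the coefficients of \<open>f\<close> in the last column.\<close>

definition companion_mat :: "'a :: field poly \<Rightarrow> 'a mat" where
  "companion_mat f = mat (degree f) (degree f)
     (\<lambda>(i, j). if j = degree f - 1 then - coeff f i else if i = j + 1 then 1 else 0)"

text \<open>
  The scalars range over the units of the algebraic closure, so the rank is taken there.
  As the ranks are natural numbers, the infimum of this nonempty set is its minimum.
\<close>

definition supp :: "'a :: field mat \<Rightarrow> nat" where
  "supp g = (INF l \<in> - {0 :: 'a alg_closure}.
     vec_space.rank (dim_row g) (map_mat to_ac g - l \<cdot>\<^sub>m 1\<^sub>m (dim_row g)))"

end

theory Submission
  imports Defs "HOL-Library.Cardinality"
begin

text \<open>
  Take \<open>p\<close> to be the minimal polynomial of an element \<open>\<beta>\<close> with \<open>\<beta>\<^sup>N = 1\<close>, where \<open>N = 8^(d/2) + 1\<close>, that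
  lies in no proper subfield of the field with \<open>8^d\<close> elements.  Then \<open>p\<close> is palindromic, and reversing
  the coordinates in each block conjugates \<open>c = C(p) \<oplus> \<dots> \<oplus> C(p)\<close> to its inverse.  The matrices commuting with
  \<open>c\<close> are \<open>8^(n m)\<close> in number, and a positive proportion of them, bounded away from zero, have
  determinant 1; so \<open>|S|\<close> is \<open>8^(n^2 - n m)\<close> up to a bounded factor.

  For \<open>x\<^sub>s\<close> take a diagonal matrix all but \<open>s\<close> of whose entries equal some \<open>\<mu> \<noteq> 1\<close>.  If \<open>x\<^sub>s = a b\<^sup>-\<^sup>1\<close> with
  \<open>a, b \<in> S\<close>, then \<open>a\<close> and \<open>\<mu> b\<close> agree on a subspace of codimension \<open>s < m\<close>; by dimension, some
  \<open>v \<noteq> 0\<close> has \<open>a\<^sup>j v = \<mu>\<^sup>j b\<^sup>j v\<close> for all \<open>j \<le> d\<close>.  Hence both \<open>p(T)\<close> and \<open>p(\<mu> T)\<close> annihilate \<open>v\<close> when \<open>T\<close>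
  acts as \<open>b\<close>, and these are coprime because \<open>7\<close> does not divide \<open>d\<close> and so \<open>\<mu>\<^sup>d \<noteq> 1\<close>.
\<close>

section \<open>Finite fields and polynomials\<close>

text \<open>The library version requires the class \<open>finite_field\<close>, to which the sort \<open>{field, finite}\<close> is not subordinate.\<close>

lemma finite_field_power_CARD:
  fixes x :: "'a::{field,finite}"
  shows "x ^ CARD('a) = x"
proof (cases "x = 0")
  case False
  \<comment> \<open>Multiplication by \<open>x \<noteq> 0\<close> permutes the nonzero elements;
    cancelling their product gives Fermat's identity \<open>x ^ (q - 1) = 1\<close>.\<close>
  have "(\<Prod>y\<in>UNIV - {0}. x * y) = (\<Prod>y\<in>UNIV - {0}. y)"
    by (rule prod.reindex_bij_witness[of _ "\<lambda>y. y / x" "\<lambda>y. x * y"]) (use False in auto)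
  then have "x ^ (CARD('a) - 1) = 1"
    by (simp add: prod.distrib)
  moreover have "CARD('a) = Suc (CARD('a) - 1)"
    using finite_UNIV_card_ge_0[where 'a = 'a] by simp
  ultimately show ?thesis
    by (metis power_Suc2 mult_1)
qed simp

text \<open>Translation by 1 permutes the field, so comparing the sums of all elements gives
  \<open>8 = 2 ^ 3 = 0\<close>, hence \<open>2 = 0\<close>.\<close>

lemma CHAR_card8:
  assumes "card (UNIV :: 'a::{field,finite} set) = 8"
  shows "CHAR('a) = 2"
proof -
  have "(\<Sum>x\<in>UNIV. x + 1) = (\<Sum>x\<in>UNIV. x :: 'a)"
    by (rule sum.reindex_bij_witness[of _ "\<lambda>y. y - 1" "\<lambda>y. y + 1"]) auto
  then have "of_nat 8 = (0 :: 'a)"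
    using assms by (simp add: sum.distrib)
  moreover have "of_nat 8 = (2::'a) ^ 3" by simp
  ultimately have "(2::'a) = 0" by (metis power_eq_0_iff)
  then have "CHAR('a) dvd 2"
    by (metis of_nat_eq_0_iff_char_dvd of_nat_numeral)
  then show ?thesis
    by (metis CHAR_not_1' dvd_antisym dvd_refl two_is_prime_nat prime_nat_iff One_nat_def)
qed

lemma uminus_char2: "CHAR('a::ring_1) = 2 \<Longrightarrow> - x = (x::'a)"
  by (metis add_eq_0_iff2 mult_2 mult_zero_left of_nat_CHAR of_nat_numeral)

text \<open>Coefficient lists of length \<open>n\<close> parametrize these polynomials. The disjunct
  \<open>f = 0\<close> covers \<open>n = 0\<close>, where no degree is below the bound.\<close>

lemma card_polys_degree_less:
  "finite {f :: 'a::{zero,finite} poly. degree f < n \<or> f = 0} \<and>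
   card {f :: 'a poly. degree f < n \<or> f = 0} = CARD('a) ^ n"
proof -
  have bij: "bij_betw (\<lambda>xs. Poly xs) {xs. set xs \<subseteq> (UNIV::'a set) \<and> length xs = n}
      {f :: 'a poly. degree f < n \<or> f = 0}"
  proof (rule bij_betw_byWitness[where f' = "\<lambda>f. map (coeff f) [0..<n]"])
    show "\<forall>a\<in>{xs. set xs \<subseteq> (UNIV::'a set) \<and> length xs = n}. map (coeff (Poly a)) [0..<n] = a"
      by (auto simp: nth_default_def intro!: nth_equalityI)
    show "\<forall>a'\<in>{f :: 'a poly. degree f < n \<or> f = 0}. Poly (map (coeff a') [0..<n]) = a'"
      by (auto simp: poly_eq_iff nth_default_def coeff_eq_0)
    show "Poly ` {xs. set xs \<subseteq> (UNIV::'a set) \<and> length xs = n} \<subseteq> {f. degree f < n \<or> f = 0}"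
    proof safe
      fix xs :: "'a list" assume "Poly xs \<noteq> 0" "n = length xs"
      moreover have "coeff (Poly xs) i = 0" if "i \<ge> length xs" for i
        using that by (simp add: nth_default_def)
      ultimately show "degree (Poly xs) < length xs"
        by (metis leading_coeff_0_iff not_le)
    qed
  qed auto
  have "finite {xs. set xs \<subseteq> (UNIV::'a set) \<and> length xs = n}"
    by (rule finite_lists_length_eq) simp
  moreover have "card {xs. set xs \<subseteq> (UNIV::'a set) \<and> length xs = n} = CARD('a) ^ n"
    by (rule card_lists_length_eq) simp
  ultimately show ?thesis
    using bij_betw_finite[OF bij] bij_betw_same_card[OF bij] by simp
qed

text \<open>A nonzero element of least degree in the ideal generated by \<open>f\<close> and
  \<open>p\<close> divides both; were it not a unit, irreducibility would give
  \<open>p dvd f\<close>.\<close>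

lemma irreducible_bezout:
  fixes p f :: "'a::field poly"
  assumes p: "irreducible p" and f: "\<not> p dvd f"
  obtains s t where "s * f + t * p = 1"
proof -
  define I where "I = {s * f + t * p | s t. True}"
  have "p \<in> I" "f \<in> I" unfolding I_def
    by (auto intro: exI[of _ 0] exI[of _ 1])
  have lin: "a * u + v \<in> I" if uv: "u \<in> I" "v \<in> I" for a u v
  proof -
    obtain s t s' t' where "u = s * f + t * p" "v = s' * f + t' * p"
      using uv unfolding I_def by blast
    then have "a * u + v = (a * s + s') * f + (a * t + t') * p"
      by (simp add: algebra_simps)
    then show ?thesis unfolding I_def by blast
  qed
  have "p \<noteq> 0" using p by auto
  obtain g where g: "g \<in> I" "g \<noteq> 0" and min: "\<And>u. u \<in> I \<Longrightarrow> u \<noteq> 0 \<Longrightarrow> degree g \<le> degree u"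
    using ex_has_least_nat[of "\<lambda>u. u \<in> I \<and> u \<noteq> 0" p degree] \<open>p \<in> I\<close> \<open>p \<noteq> 0\<close> by auto
  have dvd: "g dvd u" if "u \<in> I" for u
  proof (rule ccontr)
    assume "\<not> g dvd u"
    then have nz: "u mod g \<noteq> 0" by (simp add: dvd_eq_mod_eq_0)
    have "u mod g = - (u div g) * g + u"
      by (metis add.commute diff_conv_add_uminus minus_div_mult_eq_mod mult_minus_left)
    then have "u mod g \<in> I" using lin[OF g(1) that] by metis
    then show False using min[OF _ nz] degree_mod_less'[OF g(2) nz] by simp
  qed
  have "is_unit g"
  proof (rule ccontr)
    assume "\<not> is_unit g"
    then have "p dvd g"
      using p dvd[OF \<open>p \<in> I\<close>] irreducibleD' by blast
    then show False using dvd[OF \<open>f \<in> I\<close>] f dvd_trans by blast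
  qed
  then obtain w where "1 = w * g" by (metis dvdE mult.commute)
  then have "1 \<in> I" using lin[OF g(1), of 0 w] lin[OF \<open>p \<in> I\<close> \<open>p \<in> I\<close>, of "-1"] by auto
  then show ?thesis using that unfolding I_def by force
qed

section \<open>Palindromic irreducible polynomials\<close>

text \<open>The derivative \<open>N T^(N - 1)\<close> vanishes only at 0, which is no root of
  \<open>T^N - 1\<close>; so this polynomial has simple roots and splits into \<open>N\<close>
  distinct linear factors.\<close>

lemma card_roots_of_unity:
  fixes N :: nat
  assumes N: "of_nat N \<noteq> (0 :: 'a::alg_closed_field)" "N > 0"
  shows "card {x :: 'a. x ^ N = 1} = N"
proof -
  define P :: "'a poly" where "P = monom 1 N - 1"
  have coeffP: "coeff P N = 1"
    using N by (simp add: P_def)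
  then have P0: "P \<noteq> 0" by auto
  have degP: "degree P = N"
    by (intro antisym degree_le le_degree) (use N coeffP in \<open>auto simp: P_def\<close>)
  have polyP: "poly P x = x ^ N - 1" for x
    by (simp add: P_def poly_monom)
  have ord1: "order x P \<le> 1" for x
  proof (rule ccontr)
    assume "\<not> order x P \<le> 1"
    then have "[:-x, 1:] ^ 2 dvd P"
      using order_1[of x P] le_imp_power_dvd[of 2 "order x P" "[:-x, 1:]"] dvd_trans by fastforce
    then obtain R where R: "P = [:-x, 1:] ^ 2 * R" by (elim dvdE)
    obtain L where L: "L = [:-x, 1:]" "poly L x = 0" by simp
    have "P = L * (L * R)"
      unfolding R L(1) by (simp only: power2_eq_square mult.assoc)
    then have "poly P x = 0" "poly (pderiv P) x = 0"
      using L(2) by (simp_all add: pderiv_mult)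
    moreover have "pderiv P = monom (of_nat N) (N - 1)"
      by (simp add: P_def pderiv_monom pderiv_diff)
    ultimately have "x ^ N = 1" "x ^ (N - 1) = 0"
      using N by (simp_all add: polyP poly_monom)
    then show False using N by (metis power_eq_0_iff power_0_left zero_neq_one gr_implies_not0)
  qed
  obtain A where A: "size A = degree P" "P = smult (lead_coeff P) (\<Prod>x\<in>#A. [:-x, 1:])"
    using alg_closed_imp_factorization[OF P0] by blast
  have "proots (\<Prod>x\<in>#A. [:-x, 1:]) = A"
  proof (induction A)
    case (add x A)
    have "(\<Prod>x\<in>#A. [:-x, 1:]) \<noteq> 0" by (auto simp: prod_mset_zero_iff)
    then show ?case using add by (simp add: proots_mult del: mult_pCons_left)
  qed simp
  then have pA: "proots P = A"
    using A(2) P0 by (metis leading_coeff_0_iff proots_smult)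
  have "count A x = 1" if "x \<in># A" for x
    using ord1[of x] that P0 pA by (metis One_nat_def count_greater_zero_iff count_proots le_antisym Suc_leI)
  then have "size A = card (set_mset A)"
    by (simp add: size_multiset_overloaded_eq)
  also have "set_mset A = {x. x ^ N = 1}"
    using pA P0 by (auto simp: polyP)
  finally show ?thesis using A(1) degP by simp
qed

context
  assumes F8: "card (UNIV :: 'a::{field,finite} set) = 8"
begin

lemma CHAR_alg_closure_card8: "CHAR('a alg_closure) = 2"
  using CHAR_card8[OF F8] by simp

lemma frobenius_add: "((x :: 'a alg_closure) + y) ^ (8 ^ k) = x ^ (8 ^ k) + y ^ (8 ^ k)"
proof (rule freshmans_dream'[where n = "3 * k"])
  show "(8::nat) ^ k = CHAR('a alg_closure) ^ (3 * k)"
    unfolding CHAR_alg_closure_card8 power_mult by simp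
qed (unfold CHAR_alg_closure_card8, simp)

lemma frobenius_inj: "(x :: 'a alg_closure) ^ (8 ^ k) = y ^ (8 ^ k) \<Longrightarrow> x = y"
proof -
  assume "x ^ (8 ^ k) = y ^ (8 ^ k)"
  then have "(x + y) ^ (8 ^ k) = 0"
    unfolding frobenius_add using uminus_char2[OF CHAR_alg_closure_card8] by (metis add.right_inverse)
  then have "x + y = 0" by simp
  then show "x = y"
    using uminus_char2[OF CHAR_alg_closure_card8, of y] by (metis add_eq_0_iff2)
qed

lemma frobenius_to_ac: "to_ac (a :: 'a) ^ (8 ^ k) = to_ac a"
proof (induction k)
  case (Suc k)
  have "to_ac a ^ 8 = to_ac a"
    using finite_field_power_CARD[of a] unfolding F8 by (metis to_ac_power)
  then show ?case using Suc by (simp add: power_mult)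
qed simp

text \<open>The coefficients lie in the field with 8 elements and are fixed by
  \<open>x \<mapsto> x^8\<close>. Hence the roots of \<open>f\<close> are permuted among themselves
  by Frobenius.\<close>

lemma poly_frobenius:
  "poly (map_poly to_ac (f :: 'a poly)) (x ^ (8 ^ k)) = poly (map_poly to_ac f) x ^ (8 ^ k)"
  by (induction f) (simp_all add: map_poly_pCons frobenius_add frobenius_to_ac power_mult_distrib zero_power)

text \<open>There are more roots of unity of order dividing \<open>8^h + 1\<close> than elements fixed by some \<open>8^e\<close>-th power,
  \<open>1 \<le> e < h\<close>, and 1 is the only such root with \<open>\<beta>^(8^h) = \<beta>\<close>.\<close>

lemma exists_inverted_generator:
  assumes h: "h \<ge> (1::nat)"
  obtains \<beta> :: "'a alg_closure" where "\<beta> ^ (8 ^ h + 1) = 1" "\<And>e. 1 \<le> e \<Longrightarrow> e < 2 * h \<Longrightarrow> \<beta> ^ (8 ^ e) \<noteq> \<beta>"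
proof -
  define N where "N = (8::nat) ^ h + 1"
  have two: "(2 :: 'a alg_closure) = 0"
    using CHAR_alg_closure_card8 of_nat_CHAR[where 'a = "'a alg_closure"] by simp
  \<comment> \<open>As \<open>8 = 0\<close> and \<open>h \<ge> 1\<close>, \<open>N\<close> is 1 in
    the field, so \<open>N\<close> is prime to the characteristic and all \<open>N\<close> roots of
    unity exist.\<close>
  have "(8 :: 'a alg_closure) = 0" using two by (metis mult_zero_left mult_2 numeral_Bit0 add.right_neutral)
  then have "of_nat N = (1 :: 'a alg_closure)"
    using h by (simp add: N_def zero_power)
  then have cardN: "card {x :: 'a alg_closure. x ^ N = 1} = N"
    by (intro card_roots_of_unity) (simp_all, simp add: N_def)
  define B where "B e = {x :: 'a alg_closure. x ^ (8 ^ e) = x}" for e :: nat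
  have B: "finite (B e) \<and> card (B e) \<le> 8 ^ e" if "e \<ge> 1" for e
  proof -
    define Q :: "'a alg_closure poly" where "Q = monom 1 (8 ^ e) - monom 1 1"
    have "(8::nat) ^ e \<noteq> 1" using that by simp
    then have "Suc 0 \<noteq> 8 ^ e" unfolding One_nat_def by (rule not_sym)
    then have "coeff Q (8 ^ e) = 1" unfolding Q_def coeff_diff coeff_monom by simp
    then have "Q \<noteq> 0" by auto
    moreover have "degree Q \<le> 8 ^ e"
      unfolding Q_def by (intro degree_diff_le degree_monom_le order.trans[OF degree_monom_le]) auto
    moreover have "B e = {x. poly Q x = 0}"
      by (auto simp: B_def Q_def poly_monom)
    ultimately show ?thesis
      using card_poly_roots_bound[of Q] poly_roots_finite[of Q] by auto
  qed
  have geo: "1 + (\<Sum>e = 1..<h. 8 ^ e) < N"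
    unfolding N_def
  proof (induction h)
    case (Suc h)
    then show ?case by (cases "h = 0") auto
  qed simp
  define bad where "bad = insert 1 (\<Union>e\<in>{1..<h}. B e)"
  have fin: "finite bad" using B by (auto simp: bad_def)
  have "card bad \<le> 1 + card (\<Union>e\<in>{1..<h}. B e)"
    unfolding bad_def using card_insert_le_m1 by (metis add.commute card_insert_if fin finite_insert le_add2 order_refl plus_1_eq_Suc bad_def)
  also have "card (\<Union>e\<in>{1..<h}. B e) \<le> (\<Sum>e = 1..<h. card (B e))"
    by (rule card_UN_le) simp
  also have "\<dots> \<le> (\<Sum>e = 1..<h. 8 ^ e)"
    using B by (intro sum_mono) auto
  finally have "card bad < card {x :: 'a alg_closure. x ^ N = 1}"
    using geo cardN by linarith
  then have "\<not> {x :: 'a alg_closure. x ^ N = 1} \<subseteq> bad"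
    by (meson card_mono[OF fin] not_le)
  then obtain \<beta> :: "'a alg_closure" where b: "\<beta> ^ N = 1" "\<beta> \<notin> bad" by blast
  have b1: "\<beta> \<noteq> 1" and be: "\<And>e. 1 \<le> e \<Longrightarrow> e < h \<Longrightarrow> \<beta> ^ (8 ^ e) \<noteq> \<beta>"
    using b(2) by (auto simp: bad_def B_def)
  have inv: "\<beta> ^ (8 ^ h) = inverse \<beta>"
    using b(1) by (metis N_def inverse_unique mult.commute power_add power_one_right)
  have "\<beta> ^ (8 ^ e) \<noteq> \<beta>" if e: "1 \<le> e" "e < 2 * h" for e
  proof
    assume eq: "\<beta> ^ (8 ^ e) = \<beta>"
    \<comment> \<open>Small \<open>e\<close> are excluded by the choice of \<open>\<beta>\<close>.
      For \<open>e = h\<close>, \<open>\<beta>\<close> is its own inverse, and characteristic 2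
      forces \<open>\<beta> = 1\<close>. For \<open>e > h\<close>, inversion by the
      \<open>8^h\<close>-th power reflects the exponent to \<open>g = 2 * h - e < h\<close>.\<close>
    consider "e < h" | "e = h" | "h < e" by linarith
    then show False
    proof cases
      case 2
      then have "\<beta> * \<beta> = 1" using eq inv b(1)
        by (metis N_def Suc_eq_plus1 power_Suc)
      then have "\<beta> ^ (8 ^ 1) = 1 ^ (8 ^ 1)"
        by (simp add: eval_nat_numeral)
      then show False using b1 by (meson frobenius_inj)
    next
      case 3
      define g where "g = 2 * h - e"
      have g: "1 \<le> g" "g < h" using e 3 by (auto simp: g_def)
      have "inverse \<beta> = inverse (\<beta> ^ (8 ^ e))" using eq by simp
      also have "\<beta> ^ (8 ^ e) = inverse \<beta> ^ (8 ^ (h - g))"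
      proof -
        have "e = h + (h - g)" using e 3 by (simp add: g_def)
        then show ?thesis by (simp only: power_add power_mult inv)
      qed
      also have "inverse \<dots> = \<beta> ^ (8 ^ (h - g))" by (simp add: power_inverse)
      finally have "\<beta> ^ (8 ^ (h - g)) = \<beta> ^ (8 ^ h)" using inv by simp
      also have "\<dots> = (\<beta> ^ (8 ^ g)) ^ (8 ^ (h - g))"
        using g by (simp flip: power_mult power_add)
      finally have "\<beta> = \<beta> ^ (8 ^ g)" by (rule frobenius_inj)
      then show False using be g by metis
    qed (use be e eq in auto)
  qed
  then show ?thesis using that b(1) N_def by metis
qed


lemma map_poly_to_ac_add: "map_poly to_ac (f + g :: 'a poly) = map_poly to_ac f + map_poly to_ac g"
  by (rule poly_eqI) (simp add: coeff_map_poly)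

lemma map_poly_to_ac_mult: "map_poly to_ac (f * g :: 'a poly) = map_poly to_ac f * map_poly to_ac g"
  by (rule poly_eqI) (simp add: coeff_map_poly coeff_mult to_ac_sum)

lemma map_poly_to_ac_reflect: "map_poly to_ac (reflect_poly (f :: 'a poly)) = reflect_poly (map_poly to_ac f)"
  by (rule poly_eqI) (simp add: coeff_map_poly coeff_reflect_poly degree_map_poly)

text \<open>\<open>p\<close> is the minimal polynomial of the \<open>\<beta>\<close> found above.
  Frobenius conjugates bound its degree from below, a pigeonhole count from above. As
  \<open>inverse \<beta>\<close> is the conjugate \<open>\<beta> ^ (8 ^ h)\<close>, it is also a
  root of \<open>p\<close>, so \<open>\<beta>\<close> is a root of
  \<open>reflect_poly p\<close>.\<close>

lemma exists_palindromic_irreducible: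
  assumes d: "even d" "d \<ge> 2"
  obtains p :: "'a poly" where "lead_coeff p = 1" "irreducible p" "degree p = d" "reflect_poly p = p"
proof -
  define h where "h = d div 2"
  have dh: "d = 2 * h" and h1: "h \<ge> 1" using d by (auto simp: h_def)
  obtain \<beta> :: "'a alg_closure" where b1: "\<beta> ^ (8 ^ h + 1) = 1"
    and b: "\<And>e. 1 \<le> e \<Longrightarrow> e < d \<Longrightarrow> \<beta> ^ (8 ^ e) \<noteq> \<beta>"
    using exists_inverted_generator[OF h1] unfolding dh by blast
  have inv: "\<beta> ^ (8 ^ h) = inverse \<beta>"
    using b1 by (metis inverse_unique mult.commute power_add power_one_right)
  have bd: "\<beta> ^ (8 ^ d) = \<beta>"
  proof -
    have "\<beta> ^ (8 ^ d) = (\<beta> ^ (8 ^ h)) ^ (8 ^ h)"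
      unfolding dh by (simp add: mult_2 power_add flip: power_mult)
    then show ?thesis unfolding inv by (simp add: inv power_inverse)
  qed
  have b0: "\<beta> \<noteq> 0" using b1 by auto
  define ev where "ev f = poly (map_poly to_ac f) \<beta>" for f :: "'a poly"
  have ev_add: "ev (f + g) = ev f + ev g" and ev_mult: "ev (f * g) = ev f * ev g" for f g
    by (simp_all add: ev_def map_poly_to_ac_add map_poly_to_ac_mult)
  have ev_C: "ev [:a:] = to_ac a" for a by (simp add: ev_def map_poly_pCons)
  have ev_diff: "ev (f - g) = ev f - ev g" for f g
    by (metis add_diff_cancel_right' diff_add_cancel ev_add)
  \<comment> \<open>A polynomial vanishing at \<open>\<beta>\<close> vanishes at the conjugates
    \<open>\<beta> ^ (8 ^ i)\<close>, \<open>i < d\<close>, which are distinct because no smaller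
    Frobenius power fixes \<open>\<beta>\<close>.\<close>
  have low: "d \<le> degree f" if "ev f = 0" "f \<noteq> 0" for f
  proof -
    define F where "F = map_poly to_ac f"
    have "F \<noteq> 0" using that by (simp add: F_def map_poly_eq_0_iff)
    have inj: "inj_on (\<lambda>i. \<beta> ^ (8 ^ i)) {..<d}"
    proof (rule linorder_inj_onI)
      fix i j :: nat assume ij: "i < j" "i \<in> {..<d}" "j \<in> {..<d}"
      have "(\<beta> ^ (8 ^ (j - i))) ^ (8 ^ i) = \<beta> ^ (8 ^ j)"
        using ij by (simp flip: power_mult power_add)
      moreover have "\<beta> ^ (8 ^ (j - i)) \<noteq> \<beta>" using ij by (intro b) auto
      ultimately show "\<beta> ^ (8 ^ i) \<noteq> \<beta> ^ (8 ^ j)" using frobenius_inj by metis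
    qed auto
    have "(\<lambda>i. \<beta> ^ (8 ^ i)) ` {..<d} \<subseteq> {x. poly F x = 0}"
      using that(1) by (auto simp: F_def ev_def poly_frobenius)
    then have "card ((\<lambda>i. \<beta> ^ (8 ^ i)) ` {..<d}) \<le> card {x. poly F x = 0}"
      by (rule card_mono[OF poly_roots_finite[OF \<open>F \<noteq> 0\<close>]])
    then have "d \<le> card {x. poly F x = 0}"
      by (simp only: card_image[OF inj] card_lessThan)
    also have "\<dots> \<le> degree F" using card_poly_roots_bound[OF \<open>F \<noteq> 0\<close>] .
    finally show ?thesis by (simp add: F_def degree_map_poly)
  qed
  \<comment> \<open>Pigeonhole: \<open>8^(d + 1)\<close> polynomials of degree at most \<open>d\<close>, but at most \<open>8^d\<close> values at \<open>\<beta>\<close>.\<close>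
  obtain g where g: "g \<noteq> 0" "ev g = 0" "degree g \<le> d"
  proof -
    define Q :: "'a alg_closure poly" where "Q = monom 1 (8 ^ d) - monom 1 1"
    have "(8::nat) ^ d \<noteq> 1" using d by simp
    then have "Suc 0 \<noteq> 8 ^ d" unfolding One_nat_def by (rule not_sym)
    then have "coeff Q (8 ^ d) = 1" unfolding Q_def coeff_diff coeff_monom by simp
    then have "Q \<noteq> 0" by auto
    moreover have "degree Q \<le> 8 ^ d"
      unfolding Q_def by (intro degree_diff_le degree_monom_le order.trans[OF degree_monom_le]) auto
    moreover have "{x. poly Q x = 0} = {x. x ^ (8 ^ d) = x}"
      by (auto simp: Q_def poly_monom)
    ultimately have fixed_pts: "finite {x :: 'a alg_closure. x ^ (8 ^ d) = x}"
      "card {x :: 'a alg_closure. x ^ (8 ^ d) = x} \<le> 8 ^ d"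
      using card_poly_roots_bound[of Q] poly_roots_finite[of Q] by auto
    let ?P = "{f :: 'a poly. degree f < Suc d \<or> f = 0}"
    have "ev f ^ (8 ^ d) = ev f" for f
      unfolding ev_def poly_frobenius[symmetric] bd ..
    then have "ev ` ?P \<subseteq> {x. x ^ (8 ^ d) = x}" by auto
    then have "card (ev ` ?P) \<le> 8 ^ d"
      using card_mono[OF fixed_pts(1)] fixed_pts(2) order.trans by blast
    also have "\<dots> < card ?P"
      using card_polys_degree_less[of "Suc d", where 'a = 'a] F8 by simp
    finally have "\<not> inj_on ev ?P"
      using pigeonhole by blast
    then obtain f1 f2 where "f1 \<in> ?P" "f2 \<in> ?P" "ev f1 = ev f2" "f1 \<noteq> f2"
      unfolding inj_on_def by blast
    then show ?thesis
      using that[of "f1 - f2"] ev_diff degree_diff_le[of f1 d f2] by auto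
  qed
  define p where "p = smult (inverse (lead_coeff g)) g"
  have ev_smult: "ev (smult a f) = to_ac a * ev f" for a f
    using ev_mult[of "[:a:]" f] ev_C by simp
  have p: "p \<noteq> 0" "ev p = 0" "lead_coeff p = 1"
    using g by (simp_all add: p_def ev_smult)
  have degp: "degree p = d"
    using low[OF p(2,1)] g by (simp add: p_def)
  have irr: "irreducible p"
  proof (rule irreducibleI)
    show "\<not> is_unit p"
      using degp d is_unit_iff_degree[OF p(1)] by simp
    fix u v assume uv: "p = u * v"
    then have nz: "u \<noteq> 0" "v \<noteq> 0" using p(1) by auto
    have deg: "degree u + degree v = d" using degp nz uv by (simp add: degree_mult_eq)
    have "ev u = 0 \<or> ev v = 0" using p(2) unfolding uv ev_mult by simp
    then have "degree v = 0 \<or> degree u = 0"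
      using low nz deg by fastforce
    then show "is_unit u \<or> is_unit v"
      using nz is_unit_iff_degree by blast
  qed (use p in auto)
  \<comment> \<open>Otherwise \<open>p\<close> divided by \<open>T\<close> would still vanish at
    \<open>\<beta> \<noteq> 0\<close>, against \<open>low\<close>.\<close>
  have p0: "coeff p 0 \<noteq> 0"
  proof
    assume "coeff p 0 = 0"
    then obtain q where q: "p = pCons 0 q" by (metis coeff_pCons_0 pCons_cases)
    have "ev p = \<beta> * ev q" by (simp add: q ev_def map_poly_pCons)
    then have "ev q = 0" using p b0 by simp
    moreover have "q \<noteq> 0" using q p(1) by auto
    ultimately have "d \<le> degree q" by (rule low)
    then show False using degp q \<open>q \<noteq> 0\<close> by simp
  qed
  have "ev (reflect_poly p) = 0"
  proof -
    have "poly (map_poly to_ac p) (inverse \<beta>) = 0"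
      unfolding inv[symmetric] poly_frobenius using p(2) by (simp add: ev_def)
    then show ?thesis
      using poly_reflect_poly_nz[OF b0] by (simp add: ev_def map_poly_to_ac_reflect)
  qed
  define a where "a = coeff p 0"
  \<comment> \<open>Subtracting \<open>a p\<close> cancels the coefficient of degree
    \<open>d\<close>, so \<open>r\<close> has too small a degree to vanish at \<open>\<beta>\<close>
    unless it is 0. Constant coefficients then give \<open>a * a = 1\<close>, and
    \<open>a = 1\<close> in characteristic 2.\<close>
  define r where "r = reflect_poly p - smult a p"
  have "ev r = 0"
    using \<open>ev (reflect_poly p) = 0\<close> p by (simp add: r_def ev_diff ev_smult)
  moreover have "r = 0 \<or> degree r < d"
  proof -
    have "coeff r d = 0"
      using degp p(3) by (simp add: r_def coeff_reflect_poly a_def)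
    moreover have "degree r \<le> d"
      using degp p0 by (simp add: r_def degree_diff_le)
    ultimately show ?thesis
      by (metis eq_zero_or_degree_less)
  qed
  ultimately have "r = 0" using low by fastforce
  then have r: "reflect_poly p = smult a p" by (simp add: r_def)
  then have "coeff (reflect_poly p) 0 = a * a" by (simp add: a_def)
  then have "a * a = 1" using p(3) by simp
  then have "a = 1"
    by (metis square_eq_1_iff uminus_char2[OF CHAR_card8[OF F8]])
  then have "reflect_poly p = p" using r by simp
  then show ?thesis using that p(3) irr degp by blast
qed

end

section \<open>Polynomials in a matrix\<close>

text \<open>Evaluation of \<open>f\<close> at \<open>A\<close> by Horner's scheme, so that facts
  about it follow by induction on \<open>pCons\<close>.\<close>

definition poly_mat :: "'a::comm_ring_1 poly \<Rightarrow> 'a mat \<Rightarrow> 'a mat" where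
  "poly_mat f A = fold_coeffs (\<lambda>a M. a \<cdot>\<^sub>m 1\<^sub>m (dim_row A) + A * M) f (0\<^sub>m (dim_row A) (dim_row A))"

lemma poly_mat_0 [simp]: "poly_mat 0 A = 0\<^sub>m (dim_row A) (dim_row A)"
  by (simp add: poly_mat_def)

lemma poly_mat_pCons:
  assumes "A \<in> carrier_mat n n"
  shows "poly_mat (pCons a f) A = a \<cdot>\<^sub>m 1\<^sub>m n + A * poly_mat f A"
  using assms by (cases "a = 0 \<and> f = 0") (auto simp: poly_mat_def)

lemma poly_mat_carrier [simp]:
  assumes "A \<in> carrier_mat n n"
  shows "poly_mat f A \<in> carrier_mat n n"
  using assms by (induction f) (simp_all add: poly_mat_pCons)

lemma smult_mat_mult_vec:
  fixes A :: "'a::comm_ring_1 mat"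
  assumes "A \<in> carrier_mat nr nc" "v \<in> carrier_vec nc"
  shows "(a \<cdot>\<^sub>m A) *\<^sub>v v = a \<cdot>\<^sub>v (A *\<^sub>v v)"
  using assms by (intro eq_vecI) (auto simp: scalar_prod_def sum_distrib_left mult.assoc)

lemma poly_mat_add:
  assumes A: "A \<in> carrier_mat n n"
  shows "poly_mat (f + g) A = poly_mat f A + poly_mat g A"
proof (induction f g rule: poly_induct2)
  case (pCons a p b q)
  have "poly_mat (pCons a p + pCons b q) A
      = (a + b) \<cdot>\<^sub>m 1\<^sub>m n + A * (poly_mat p A + poly_mat q A)"
    using pCons by (simp add: poly_mat_pCons[OF A])
  also have "\<dots> = (a \<cdot>\<^sub>m 1\<^sub>m n + b \<cdot>\<^sub>m 1\<^sub>m n) + (A * poly_mat p A + A * poly_mat q A)"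
    using A by (simp add: add_smult_distrib_right_mat[of _ n n] mult_add_distrib_mat[OF A, of _ n])
  also have "\<dots> = poly_mat (pCons a p) A + poly_mat (pCons b q) A"
  proof -
    have "(a \<cdot>\<^sub>m 1\<^sub>m n + b \<cdot>\<^sub>m 1\<^sub>m n) + (P + Q) = (a \<cdot>\<^sub>m 1\<^sub>m n + P) + (b \<cdot>\<^sub>m 1\<^sub>m n + Q)"
      if "P \<in> carrier_mat n n" "Q \<in> carrier_mat n n" for P Q :: "'a mat"
      using that by (intro eq_matI) auto
    then show ?thesis unfolding poly_mat_pCons[OF A] using A by simp
  qed
  finally show ?case .
qed (use A in simp)

lemma poly_mat_smult:
  assumes A: "A \<in> carrier_mat n n"
  shows "poly_mat (smult a f) A = a \<cdot>\<^sub>m poly_mat f A"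
proof (induction f)
  case (pCons b f)
  have "poly_mat (smult a (pCons b f)) A = (a * b) \<cdot>\<^sub>m 1\<^sub>m n + A * (a \<cdot>\<^sub>m poly_mat f A)"
    using pCons by (simp add: poly_mat_pCons[OF A])
  also have "A * (a \<cdot>\<^sub>m poly_mat f A) = a \<cdot>\<^sub>m (A * poly_mat f A)"
    using A by (simp add: mult_smult_distrib[of _ n n _ n])
  also have "(a * b) \<cdot>\<^sub>m 1\<^sub>m n + a \<cdot>\<^sub>m (A * poly_mat f A) = a \<cdot>\<^sub>m (poly_mat (pCons b f) A)"
  proof -
    have "(a * b) \<cdot>\<^sub>m 1\<^sub>m n + a \<cdot>\<^sub>m P = a \<cdot>\<^sub>m (b \<cdot>\<^sub>m 1\<^sub>m n + P)"
      if "P \<in> carrier_mat n n" for P :: "'a mat"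
      using that by (intro eq_matI) (auto simp: algebra_simps)
    then show ?thesis unfolding poly_mat_pCons[OF A] using A by simp
  qed
  finally show ?case .
qed (use A in simp)

lemma poly_mat_mult:
  assumes A: "A \<in> carrier_mat n n"
  shows "poly_mat (f * g) A = poly_mat f A * poly_mat g A"
proof (induction f)
  case (pCons a f)
  let ?P = "poly_mat f A" and ?Q = "poly_mat g A"
  have P: "?P \<in> carrier_mat n n" and Q: "?Q \<in> carrier_mat n n"
    using A by simp_all
  have AP: "A * ?P \<in> carrier_mat n n" and APQ: "A * (?P * ?Q) \<in> carrier_mat n n"
    using A P Q by (meson mult_carrier_mat)+
  have add0: "0 \<cdot>\<^sub>m 1\<^sub>m n + M = M" if "M \<in> carrier_mat n n" for M :: "'a mat"
    using that by (intro eq_matI) auto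
  have "poly_mat (pCons a f * g) A = a \<cdot>\<^sub>m ?Q + (0 \<cdot>\<^sub>m 1\<^sub>m n + A * (?P * ?Q))"
    using pCons A by (simp add: poly_mat_add poly_mat_smult poly_mat_pCons)
  also have "0 \<cdot>\<^sub>m 1\<^sub>m n + A * (?P * ?Q) = A * ?P * ?Q"
    using add0[OF APQ] assoc_mult_mat[OF A P Q] by simp
  also have "a \<cdot>\<^sub>m ?Q + A * ?P * ?Q = (a \<cdot>\<^sub>m 1\<^sub>m n + A * ?P) * ?Q"
    using add_mult_distrib_mat[OF _ AP Q, of "a \<cdot>\<^sub>m 1\<^sub>m n"]
      mult_smult_assoc_mat[OF one_carrier_mat Q, of a] left_mult_one_mat[OF Q] by simp
  finally show ?case by (simp add: poly_mat_pCons[OF A])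
qed (use A left_mult_zero_mat[OF poly_mat_carrier[OF A, of g]] in simp)

lemma poly_mat_1:
  assumes "A \<in> carrier_mat n n"
  shows "poly_mat 1 A = 1\<^sub>m n"
  using assms by (auto simp: one_pCons poly_mat_pCons intro!: eq_matI)

text \<open>Serves twice: with \<open>A = B\<close> for matrices in a centralizer, and with
  \<open>H\<close> a conjugating matrix, to carry annihilating polynomials over to
  conjugates.\<close>

lemma poly_mat_comm:
  assumes A: "A \<in> carrier_mat n n" and H: "H \<in> carrier_mat n n" and eq: "H * A = B * H"
    and B: "B \<in> carrier_mat n n"
  shows "H * poly_mat f A = poly_mat f B * H"
proof (induction f)
  case (pCons a f)
  let ?P = "poly_mat f A" and ?Q = "poly_mat f B"
  have P: "?P \<in> carrier_mat n n" and Q: "?Q \<in> carrier_mat n n"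
    using A B by simp_all
  have AP: "A * ?P \<in> carrier_mat n n" and BQ: "B * ?Q \<in> carrier_mat n n"
    using A B P Q by (meson mult_carrier_mat)+
  have "H * (A * ?P) = (B * H) * ?P"
    using assoc_mult_mat[OF H A P] eq by simp
  also have "\<dots> = B * (?Q * H)"
    using assoc_mult_mat[OF B H P] pCons by simp
  also have "\<dots> = B * ?Q * H"
    using assoc_mult_mat[OF B Q H] by simp
  finally have *: "H * (A * ?P) = B * ?Q * H" .
  have "H * (a \<cdot>\<^sub>m 1\<^sub>m n + A * ?P) = a \<cdot>\<^sub>m H + B * ?Q * H"
    using mult_add_distrib_mat[OF H _ AP, of "a \<cdot>\<^sub>m 1\<^sub>m n"]
      mult_smult_distrib[OF H one_carrier_mat, of a] right_mult_one_mat[OF H] * by simp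
  also have "\<dots> = (a \<cdot>\<^sub>m 1\<^sub>m n + B * ?Q) * H"
    using add_mult_distrib_mat[OF _ BQ H, of "a \<cdot>\<^sub>m 1\<^sub>m n"]
      mult_smult_assoc_mat[OF one_carrier_mat H, of a] left_mult_one_mat[OF H] by simp
  finally show ?case
    by (simp add: poly_mat_pCons[OF A] poly_mat_pCons[OF B])
qed (use A B H in simp)

text \<open>The vector \<open>T^i v\<close> of the \<open>F[T]\<close>-module on which
  \<open>T\<close> acts as \<open>A\<close>.\<close>

definition krylov :: "'a::comm_ring_1 mat \<Rightarrow> nat \<Rightarrow> 'a vec \<Rightarrow> 'a vec" where
  "krylov A i v = ((\<lambda>w. A *\<^sub>v w) ^^ i) v"

lemma krylov_0 [simp]: "krylov A 0 v = v"
  and krylov_Suc: "krylov A (Suc i) v = A *\<^sub>v krylov A i v"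
  by (simp_all add: krylov_def)

lemma krylov_Suc_right: "krylov A (Suc i) v = krylov A i (A *\<^sub>v v)"
  by (simp add: krylov_def funpow_swap1)

lemma krylov_carrier [simp]:
  "A \<in> carrier_mat n n \<Longrightarrow> v \<in> carrier_vec n \<Longrightarrow> krylov A i v \<in> carrier_vec n"
  by (induction i) (simp_all add: krylov_Suc)

lemma krylov_comm:
  assumes "A \<in> carrier_mat n n" "H \<in> carrier_mat n n" "B \<in> carrier_mat n n" "H * A = B * H" "v \<in> carrier_vec n"
  shows "H *\<^sub>v krylov A i v = krylov B i (H *\<^sub>v v)"
proof (induction i)
  case (Suc i)
  have "H *\<^sub>v (A *\<^sub>v krylov A i v) = B *\<^sub>v (H *\<^sub>v krylov A i v)"
    using assoc_mult_mat_vec[OF assms(2,1), of "krylov A i v"] assoc_mult_mat_vec[OF assms(3,2), of "krylov A i v"]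
      assms by simp
  then show ?case using Suc by (simp add: krylov_Suc)
qed simp

text \<open>Stated for one coordinate, so that only sums of scalars occur, and with a free bound
  \<open>k\<close>, since both \<open>d\<close> and \<open>Suc d\<close> terms are wanted later. The
  induction moves one factor \<open>A\<close> onto the vector, so \<open>v\<close> and
  \<open>k\<close> must vary.\<close>

lemma poly_mat_mult_vec_nth:
  assumes A: "A \<in> carrier_mat n n" and r: "r < n" and "v \<in> carrier_vec n" "degree f < k"
  shows "(poly_mat f A *\<^sub>v v) $ r = (\<Sum>i<k. coeff f i * krylov A i v $ r)"
  using assms(3-)
proof (induction f arbitrary: v k)
  case 0
  then show ?case using A r by simp
next
  case (pCons a f)
  obtain k' where k: "k = Suc k'" using pCons.prems by (cases k) auto
  have "poly_mat (pCons a f) A *\<^sub>v v = a \<cdot>\<^sub>v v + poly_mat f A *\<^sub>v (A *\<^sub>v v)"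
  proof -
    have "A * poly_mat f A = poly_mat f A * A"
      using poly_mat_comm[OF A A refl A] .
    moreover have "poly_mat f A * A \<in> carrier_mat n n"
      using A by (meson mult_carrier_mat poly_mat_carrier)
    ultimately show ?thesis
      using A pCons.prems(1) add_mult_distrib_mat_vec[of "a \<cdot>\<^sub>m 1\<^sub>m n" n n "poly_mat f A * A" v]
        smult_mat_mult_vec[OF one_carrier_mat pCons.prems(1), of a]
        assoc_mult_mat_vec[OF poly_mat_carrier[OF A] A pCons.prems(1)]
      by (simp add: poly_mat_pCons)
  qed
  moreover have "(poly_mat f A *\<^sub>v (A *\<^sub>v v)) $ r = (\<Sum>i<k'. coeff f i * krylov A i (A *\<^sub>v v) $ r)"
  \<comment> \<open>For \<open>f = 0\<close> the bound \<open>k'\<close> may be 0, and the induction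
    hypothesis, which asks for \<open>degree f < k'\<close>, does not apply.\<close>
  proof (cases "f = 0")
    case True
    then show ?thesis using A r pCons.prems(1) by (simp add: scalar_prod_left_zero[of _ n])
  next
    case False
    then show ?thesis using pCons k A by simp
  qed
  ultimately show ?case
    unfolding k sum.lessThan_Suc_shift
    using A r pCons.prems carrier_matD(1)[OF poly_mat_carrier[OF A, of f]]
    by (simp add: krylov_Suc_right del: index_mult_mat_vec)
qed

lemma mult_mat_zero_vec:
  fixes A :: "'a::semiring_0 mat"
  shows "A \<in> carrier_mat nr nc \<Longrightarrow> A *\<^sub>v 0\<^sub>v nc = 0\<^sub>v nr"
  by (intro eq_vecI) (auto simp: scalar_prod_def)

lemma zero_mat_mult_vec:
  fixes v :: "'a::semiring_0 vec"
  shows "v \<in> carrier_vec nc \<Longrightarrow> 0\<^sub>m nr nc *\<^sub>v v = 0\<^sub>v nr"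
  by (intro eq_vecI) (auto simp: scalar_prod_def)

text \<open>As \<open>p\<close> annihilates \<open>A\<close>, the space is a vector space over the
  field \<open>F[T]/(p)\<close>, in which \<open>f\<close> is invertible: apply
  \<open>s * f + t * p = 1\<close> to \<open>v\<close>.\<close>

lemma poly_mat_irreducible_inj:
  fixes A :: "'a::field mat"
  assumes A: "A \<in> carrier_mat n n" and p: "irreducible p" "poly_mat p A = 0\<^sub>m n n"
    and f: "\<not> p dvd f" and v: "v \<in> carrier_vec n" "poly_mat f A *\<^sub>v v = 0\<^sub>v n"
  shows "v = 0\<^sub>v n"
proof -
  obtain s t where st: "s * f + t * p = 1"
    using irreducible_bezout[OF p(1) f] .
  have C: "poly_mat g A \<in> carrier_mat n n" for g using A by simp
  have "v = poly_mat (s * f + t * p) A *\<^sub>v v"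
    unfolding st poly_mat_1[OF A] using v by simp
  also have "\<dots> = poly_mat s A *\<^sub>v (poly_mat f A *\<^sub>v v) + poly_mat t A *\<^sub>v (poly_mat p A *\<^sub>v v)"
    using A v(1) add_mult_distrib_mat_vec[OF C C v(1), of "s * f" "t * p"]
      assoc_mult_mat_vec[OF C C v(1), of s f] assoc_mult_mat_vec[OF C C v(1), of t p]
    by (simp add: poly_mat_add[OF A] poly_mat_mult[OF A])
  also have "\<dots> = 0\<^sub>v n"
    using mult_mat_zero_vec[OF C] zero_mat_mult_vec[OF v(1)] v p by simp
  finally show ?thesis .
qed

lemma krylov_zero: "A \<in> carrier_mat n n \<Longrightarrow> krylov A i (0\<^sub>v n) = 0\<^sub>v n"
  by (induction i) (simp_all add: krylov_Suc mult_mat_zero_vec)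

section \<open>Direct sums of companion matrices\<close>

text \<open>Trades the recursion over blocks for quotients and remainders of indices, the form in
  which all later computations are done.\<close>

lemma diag_block_mat_replicate:
  assumes C: "C \<in> carrier_mat d d" and d: "d > 0"
  shows "diag_block_mat (replicate m C) =
    mat (d * m) (d * m) (\<lambda>(i, j). if i div d = j div d then C $$ (i mod d, j mod d) else 0)"
proof (induction m)
  case (Suc m)
  have idx: "(x - d) mod d = x mod d" "x div d = Suc ((x - d) div d)" if "\<not> x < d" for x :: nat
    using that d by (simp_all add: mod_if le_div_geq)
  show ?case
    unfolding replicate_Suc diag_block_mat.simps Let_def Suc.IH using C d
    by (intro eq_matI) (auto simp: idx div_less mod_less less_diff_conv2 not_less split: if_splits)
qed auto

lemma sum_block:
  fixes g :: "nat \<Rightarrow> 'b::comm_monoid_add"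
  assumes "d > 0" "j < m"
  shows "(\<Sum>k<d * m. if k div d = j then g k else 0) = (\<Sum>i<d. g (j * d + i))"
proof -
  have "(\<Sum>k<d * m. if k div d = j then g k else 0) = (\<Sum>k\<in>{k. k < d * m \<and> k div d = j}. g k)"
    by (simp add: sum.If_cases Int_def)
  also have "\<dots> = (\<Sum>i<d. g (j * d + i))"
  proof (rule sum.reindex_bij_witness[of _ "\<lambda>i. j * d + i" "\<lambda>k. k mod d"])
    fix i assume i: "i \<in> {..<d}"
    have "j * d + i < Suc j * d" using i by simp
    also have "\<dots> \<le> d * m" using assms by (metis Suc_leI mult.commute mult_le_mono1)
    finally show "j * d + i \<in> {k. k < d * m \<and> k div d = j}" using i by simp
  qed (use assms in auto)
  finally show ?thesis .
qed

lemma eq_matI_unit_vec: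
  fixes A B :: "'a::semiring_1 mat"
  assumes A: "A \<in> carrier_mat n k" and B: "B \<in> carrier_mat n k"
    and eq: "\<And>j. j < k \<Longrightarrow> A *\<^sub>v unit_vec k j = B *\<^sub>v unit_vec k j"
  shows "A = B"
proof (rule eq_matI)
  fix i j assume ij: "i < dim_row B" "j < dim_col B"
  then have "(A *\<^sub>v unit_vec k j) $ i = A $$ (i, j)" "(B *\<^sub>v unit_vec k j) $ i = B $$ (i, j)"
    using A B by (auto simp: scalar_prod_right_unit)
  then show "A $$ (i, j) = B $$ (i, j)" using eq ij B by auto
qed (use A B in auto)

text \<open>\<open>d\<close>, \<open>n\<close> and \<open>c\<close> are parameters tied by
  equations, so that the results can be used both for the palindromic \<open>p\<close> and for
  \<open>T - 1\<close>, where \<open>c\<close> is the identity.\<close>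

locale block_companion =
  fixes p :: "'a::field poly" and m d n :: nat and c :: "'a mat"
  assumes irr: "irreducible p" and monic: "lead_coeff p = 1"
    and d_def: "d = degree p" and n_def: "n = d * m"
    and c_def: "c = diag_block_mat (replicate m (companion_mat p))"
begin

lemma d_pos: "d > 0"
  using irr is_unit_iff_degree[of p] irreducible_not_unit[OF irr] unfolding d_def by fastforce

lemma c_eq: "c = mat n n (\<lambda>(i, j). if i div d = j div d then
    (if j mod d = d - 1 then - coeff p (i mod d) else if i mod d = j mod d + 1 then 1 else 0) else 0)"
proof -
  have "companion_mat p \<in> carrier_mat d d" by (simp add: companion_mat_def d_def)
  from diag_block_mat_replicate[OF this d_pos] show ?thesis
    unfolding c_def n_def using d_pos
    by (auto intro!: eq_matI simp: companion_mat_def d_def[symmetric])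
qed

lemma c_carrier [simp]: "c \<in> carrier_mat n n"
  by (simp add: c_eq)

lemma index_bound: "j < m \<Longrightarrow> i < d \<Longrightarrow> j * d + i < n"
proof -
  assume "j < m" "i < d"
  then have "j * d + i < Suc j * d" by simp
  also have "\<dots> \<le> m * d" using \<open>j < m\<close> by (intro mult_le_mono1) simp
  finally show ?thesis by (simp add: n_def mult.commute)
qed

lemma c_unit:
  assumes "k < n" "Suc (k mod d) < d"
  shows "c *\<^sub>v unit_vec n k = unit_vec n (Suc k)"
proof -
  have mod: "Suc k mod d = Suc (k mod d)" and div: "Suc k div d = k div d"
    using assms(2) by (simp_all add: mod_Suc div_Suc)
  have iff: "(i div d = k div d \<and> i mod d = Suc (k mod d)) \<longleftrightarrow> i = Suc k" for i
    by (metis div mod div_mult_mod_eq)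
  show ?thesis
  proof (rule eq_vecI)
    fix i assume "i < dim_vec (unit_vec n (Suc k))"
    then have i: "i < n" by simp
    have "(c *\<^sub>v unit_vec n k) $ i = c $$ (i, k)"
      using i assms(1) carrier_matD[OF c_carrier] by (simp add: scalar_prod_right_unit[of _ n])
    also have "\<dots> = (if i = Suc k then 1 else 0)"
      using i assms iff[of i] by (auto simp: c_eq)
    finally show "(c *\<^sub>v unit_vec n k) $ i = unit_vec n (Suc k) $ i"
      using i by (simp add: unit_vec_def)
  qed (use carrier_matD[OF c_carrier] in simp)
qed

lemma c_unit_last:
  assumes "k < n" "Suc (k mod d) = d" "r < n"
  shows "(c *\<^sub>v unit_vec n k) $ r = (if r div d = k div d then - coeff p (r mod d) else 0)"
proof -
  have "k mod d = d - 1" using assms by simp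
  moreover have "(c *\<^sub>v unit_vec n k) $ r = c $$ (r, k)"
    using assms carrier_matD[OF c_carrier] by (simp add: scalar_prod_right_unit[of _ n])
  ultimately show ?thesis using assms by (simp add: c_eq)
qed

text \<open>Outside its last column a companion matrix is a shift, so each block is cyclic,
  generated by its first basis vector.\<close>

lemma krylov_unit:
  assumes j: "j < m" and i: "i < d"
  shows "krylov c i (unit_vec n (j * d)) = unit_vec n (j * d + i)"
  using i
proof (induction i)
  case (Suc i)
  have "(j * d + i) mod d = i" using Suc by simp
  then show ?case using Suc c_unit[of "j * d + i"] index_bound[OF j, of i] by (simp add: krylov_Suc)
qed simp

text \<open>The last column of a companion matrix makes \<open>p\<close> kill the generator of its
  block; as \<open>p(c)\<close> commutes with \<open>c\<close>, it kills the remaining basis vectors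
  too.\<close>

lemma poly_mat_c: "poly_mat p c = 0\<^sub>m n n"
proof (rule eq_matI_unit_vec[of _ n n])
  fix k assume k: "k < n"
  define j i where "j = k div d" and "i = k mod d"
  have ki: "k = j * d + i" "i < d" using d_pos by (simp_all add: j_def i_def)
  have j: "j < m" using k unfolding j_def n_def by (metis less_mult_imp_div_less mult.commute)
  let ?e = "unit_vec n (j * d)"
  have jd: "j * d + (d - 1) < n" "(j * d + (d - 1)) mod d = d - 1" "(j * d + (d - 1)) div d = j"
    using index_bound[OF j, of "d - 1"] d_pos
    by (simp_all del: add_diff_assoc)
  have "poly_mat p c *\<^sub>v ?e = 0\<^sub>v n"
  proof (rule eq_vecI)
    fix r assume "r < dim_vec (0\<^sub>v n)"
    then have r: "r < n" by simp
    have "(poly_mat p c *\<^sub>v ?e) $ r = (\<Sum>i<Suc d. coeff p i * krylov c i ?e $ r)"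
      by (rule poly_mat_mult_vec_nth[OF c_carrier r]) (simp_all add: d_def)
    also have "\<dots> = (\<Sum>i<d. coeff p i * krylov c i ?e $ r) + krylov c d ?e $ r"
      using monic by (simp add: d_def)
    also have "krylov c d ?e = c *\<^sub>v unit_vec n (j * d + (d - 1))"
      using krylov_Suc[of c "d - 1" ?e] krylov_unit[OF j, of "d - 1"] d_pos by simp
    also have "(c *\<^sub>v unit_vec n (j * d + (d - 1))) $ r = (if r div d = j then - coeff p (r mod d) else 0)"
      using c_unit_last[OF jd(1) _ r] jd d_pos by simp
    also have "(\<Sum>i<d. coeff p i * krylov c i ?e $ r) = (\<Sum>i<d. if i = r mod d then if r div d = j then coeff p i else 0 else 0)"
    proof (rule sum.cong[OF refl])
      fix i assume i: "i \<in> {..<d}"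
      have "r = j * d + i \<longleftrightarrow> i = r mod d \<and> r div d = j" using i by auto
      then show "coeff p i * krylov c i ?e $ r = (if i = r mod d then if r div d = j then coeff p i else 0 else 0)"
        using i r krylov_unit[OF j, of i] index_bound[OF j, of i] by auto
    qed
    also have "\<dots> = (if r div d = j then coeff p (r mod d) else 0)"
      using d_pos by (simp add: sum.delta')
    finally show "(poly_mat p c *\<^sub>v ?e) $ r = 0\<^sub>v n $ r"
      using r by (simp split: if_splits)
  qed (use carrier_matD(1)[OF poly_mat_carrier[OF c_carrier]] in simp)
  moreover have "poly_mat p c *\<^sub>v krylov c i ?e = krylov c i (poly_mat p c *\<^sub>v ?e)"
    using krylov_comm[OF c_carrier poly_mat_carrier[OF c_carrier] c_carrier]
      poly_mat_comm[OF c_carrier c_carrier refl c_carrier] by simp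
  ultimately have "poly_mat p c *\<^sub>v unit_vec n k = 0\<^sub>v n"
    using krylov_unit[OF j ki(2)] krylov_zero[OF c_carrier] ki(1) by simp
  then show "poly_mat p c *\<^sub>v unit_vec n k = 0\<^sub>m n n *\<^sub>v unit_vec n k"
    by (simp add: zero_mat_mult_vec)
qed simp_all

text \<open>The endomorphism of the \<open>F[T]\<close>-module \<open>F\<^sup>n\<close> that sends the generator of block \<open>j\<close> to \<open>W j\<close>.\<close>

definition block_hom :: "(nat \<Rightarrow> 'a vec) \<Rightarrow> 'a mat" where
  "block_hom W = mat n n (\<lambda>(r, k). krylov c (k mod d) (W (k div d)) $ r)"

lemma block_hom_carrier [simp]: "block_hom W \<in> carrier_mat n n"
  by (simp add: block_hom_def)

lemma block_hom_unit:
  assumes W: "\<And>j. W j \<in> carrier_vec n" and k: "k < n"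
  shows "block_hom W *\<^sub>v unit_vec n k = krylov c (k mod d) (W (k div d))"
proof (rule eq_vecI)
  fix r assume "r < dim_vec (krylov c (k mod d) (W (k div d)))"
  then have "r < n" using carrier_vecD[OF krylov_carrier[OF c_carrier W]] by simp
  then show "(block_hom W *\<^sub>v unit_vec n k) $ r = krylov c (k mod d) (W (k div d)) $ r"
    using k by (simp add: block_hom_def scalar_prod_right_unit[of _ n])
qed (use carrier_vecD[OF krylov_carrier[OF c_carrier W]] carrier_matD[OF block_hom_carrier] in simp)

lemma block_hom_vec_nth:
  assumes r: "r < n" and v: "v \<in> carrier_vec n"
  shows "(block_hom W *\<^sub>v v) $ r = (\<Sum>k<n. krylov c (k mod d) (W (k div d)) $ r * v $ k)"
  using r v by (simp add: block_hom_def scalar_prod_def lessThan_atLeast0)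

text \<open>On a basis vector that is not the last of its block, both sides raise the exponent by
  one. On the last one, \<open>p(c) = 0\<close> expresses \<open>T^d\<close> through lower powers
  exactly as the last column of \<open>c\<close> does.\<close>

lemma block_hom_comm:
  assumes W: "\<And>j. W j \<in> carrier_vec n"
  shows "block_hom W * c = c * block_hom W"
proof (rule eq_matI_unit_vec[of _ n n])
  fix k assume k: "k < n"
  define j i where "j = k div d" and "i = k mod d"
  have j: "j < m" using k unfolding j_def n_def by (metis less_mult_imp_div_less mult.commute)
  have i: "i < d" using d_pos by (simp add: i_def)
  have "block_hom W *\<^sub>v (c *\<^sub>v unit_vec n k) = c *\<^sub>v krylov c i (W j)"
  proof (cases "Suc i < d")
    case True
    then have s: "Suc k mod d = Suc i" "Suc k div d = j"
      by (simp_all add: mod_Suc div_Suc i_def j_def)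
    have "Suc k < n"
      using index_bound[OF j True] by (simp add: i_def j_def)
    then show ?thesis
      using c_unit[OF k] True block_hom_unit[OF W, of "Suc k"] s
      by (simp add: i_def krylov_Suc)
  next
    case False
    then have last: "Suc (k mod d) = d" using i by (simp add: i_def)
    show ?thesis
    proof (rule eq_vecI)
      fix r assume "r < dim_vec (c *\<^sub>v krylov c i (W j))"
      then have r: "r < n" using carrier_matD[OF c_carrier] by simp
      have cu: "c *\<^sub>v unit_vec n k \<in> carrier_vec n" by (simp add: mult_mat_vec_carrier[OF c_carrier])
      have "(block_hom W *\<^sub>v (c *\<^sub>v unit_vec n k)) $ r
          = (\<Sum>l<d * m. if l div d = j then krylov c (l mod d) (W j) $ r * - coeff p (l mod d) else 0)"
        unfolding block_hom_vec_nth[OF r cu] n_def[symmetric]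
        using c_unit_last[OF k last] by (intro sum.cong) (auto simp: j_def)
      also have "\<dots> = (\<Sum>l<d. krylov c l (W j) $ r * - coeff p l)"
        unfolding sum_block[OF d_pos j] using d_pos by (intro sum.cong) auto
      also have "\<dots> = krylov c d (W j) $ r"
      proof -
        have "0 = (poly_mat p c *\<^sub>v W j) $ r"
          using r W by (simp add: poly_mat_c zero_mat_mult_vec)
        also have "\<dots> = (\<Sum>l<Suc d. coeff p l * krylov c l (W j) $ r)"
          by (rule poly_mat_mult_vec_nth[OF c_carrier r W]) (simp add: d_def)
        also have "\<dots> = (\<Sum>l<d. coeff p l * krylov c l (W j) $ r) + krylov c d (W j) $ r"
          using monic by (simp add: d_def)
        finally have "krylov c d (W j) $ r = - (\<Sum>l<d. coeff p l * krylov c l (W j) $ r)"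
          by (metis add_eq_0_iff)
        then show ?thesis by (simp add: sum_negf mult.commute)
      qed
      also have "krylov c d (W j) = c *\<^sub>v krylov c i (W j)"
        using last by (simp add: i_def flip: krylov_Suc)
      finally show "(block_hom W *\<^sub>v (c *\<^sub>v unit_vec n k)) $ r = (c *\<^sub>v krylov c i (W j)) $ r" .
    qed (use carrier_matD[OF c_carrier] carrier_matD[OF block_hom_carrier] in simp)
  qed
  then show "block_hom W * c *\<^sub>v unit_vec n k = c * block_hom W *\<^sub>v unit_vec n k"
    using block_hom_unit[OF W k]
    by (simp add: assoc_mult_mat_vec[OF block_hom_carrier c_carrier]
        assoc_mult_mat_vec[OF c_carrier block_hom_carrier] i_def j_def)
qed (use mult_carrier_mat[OF block_hom_carrier c_carrier] mult_carrier_mat[OF c_carrier block_hom_carrier] in simp_all)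

text \<open>The whole commuting algebra, singular matrices included, which makes its size an exact
  power of the field size.\<close>

definition centralizer_mat :: "'a mat set" where
  "centralizer_mat = {h \<in> carrier_mat n n. h * c = c * h}"

text \<open>Some block component of \<open>v\<close> is \<open>f\<close> times the generator, with
  \<open>f \<noteq> 0\<close> of degree below \<open>d\<close>, hence with an inverse
  \<open>s\<close> modulo \<open>p\<close>. The endomorphism sending this generator to
  \<open>s w\<close> and the others to 0 takes \<open>v\<close> to \<open>f s w = w\<close>.\<close>

lemma centralizer_transitive:
  assumes v: "v \<in> carrier_vec n" "v \<noteq> 0\<^sub>v n" and w: "w \<in> carrier_vec n"
  obtains h where "h \<in> centralizer_mat" "h *\<^sub>v v = w"
proof -
  obtain k where k: "k < n" "v $ k \<noteq> 0"
    using v by (metis carrier_vecD eq_vecI index_zero_vec)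
  define j where "j = k div d"
  have j: "j < m" using k unfolding j_def n_def by (metis less_mult_imp_div_less mult.commute)
  define f where "f = (\<Sum>i<d. monom (v $ (j * d + i)) i)"
  have coeff_f: "coeff f i = (if i < d then v $ (j * d + i) else 0)" for i
    unfolding f_def by (simp add: coeff_sum)
  have "coeff f (k mod d) \<noteq> 0"
    using k d_pos by (simp add: coeff_f j_def)
  then have "f \<noteq> 0" by auto
  moreover have "degree f < d"
    using \<open>f \<noteq> 0\<close> coeff_f by (metis leading_coeff_0_iff)
  ultimately have "\<not> p dvd f"
    unfolding d_def using dvd_imp_degree_le[of p f] by auto
  then obtain s t where st: "s * f + t * p = 1"
    using irreducible_bezout[OF irr] by metis
  have C: "poly_mat g c \<in> carrier_mat n n" for g by simp
  define u where "u = poly_mat s c *\<^sub>v w"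
  have u: "u \<in> carrier_vec n" using w C by (simp add: u_def mult_mat_vec_carrier[OF C])
  define W where "W = (\<lambda>i. if i = j then u else 0\<^sub>v n)"
  have W: "W i \<in> carrier_vec n" for i using u by (simp add: W_def)
  have "block_hom W *\<^sub>v v = poly_mat f c *\<^sub>v u"
  proof (rule eq_vecI)
    fix r assume "r < dim_vec (poly_mat f c *\<^sub>v u)"
    then have r: "r < n" using carrier_matD[OF C] by simp
    have "(block_hom W *\<^sub>v v) $ r = (\<Sum>k<d * m. if k div d = j then krylov c (k mod d) u $ r * v $ k else 0)"
      unfolding block_hom_vec_nth[OF r v(1)] n_def[symmetric]
      using r krylov_zero[OF c_carrier] by (intro sum.cong) (auto simp: W_def)
    also have "\<dots> = (\<Sum>i<d. coeff f i * krylov c i u $ r)"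
      unfolding sum_block[OF d_pos j] using d_pos by (intro sum.cong) (auto simp: coeff_f)
    also have "\<dots> = (poly_mat f c *\<^sub>v u) $ r"
      using poly_mat_mult_vec_nth[OF c_carrier r u \<open>degree f < d\<close>] by simp
    finally show "(block_hom W *\<^sub>v v) $ r = (poly_mat f c *\<^sub>v u) $ r" .
  qed (use carrier_matD[OF C] carrier_matD[OF block_hom_carrier] in simp)
  also have "\<dots> = poly_mat (f * s) c *\<^sub>v w"
    unfolding u_def poly_mat_mult[OF c_carrier] using assoc_mult_mat_vec[OF C C w] by simp
  also have "\<dots> = poly_mat (s * f + t * p) c *\<^sub>v w"
  proof -
    have "poly_mat (t * p) c = 0\<^sub>m n n"
      unfolding poly_mat_mult[OF c_carrier] poly_mat_c using right_mult_zero_mat[OF C] by simp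
    then show ?thesis
      using right_add_zero_mat[OF C] by (simp add: poly_mat_add[OF c_carrier] mult.commute)
  qed
  also have "\<dots> = w" unfolding st poly_mat_1[OF c_carrier] using w by simp
  finally show ?thesis
    using that[of "block_hom W"] block_hom_comm[OF W] by (simp add: centralizer_mat_def)
qed

lemma centralizer_determined:
  assumes h: "h \<in> centralizer_mat" and k: "k < n"
  shows "h *\<^sub>v unit_vec n k = krylov c (k mod d) (h *\<^sub>v unit_vec n (k div d * d))"
proof -
  have j: "k div d < m" using k unfolding n_def by (metis less_mult_imp_div_less mult.commute)
  have "unit_vec n k = krylov c (k mod d) (unit_vec n (k div d * d))"
    using krylov_unit[OF j, of "k mod d"] d_pos by simp
  then show ?thesis
    using krylov_comm[OF c_carrier _ c_carrier] h by (simp add: centralizer_mat_def)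
qed

text \<open>The block generators form a basis over \<open>F[T]/(p)\<close>, so an endomorphism is an
  arbitrary choice of their \<open>m\<close> images.\<close>

lemma centralizer_bij:
  "bij_betw (\<lambda>h. \<lambda>j\<in>{..<m}. h *\<^sub>v unit_vec n (j * d)) centralizer_mat ({..<m} \<rightarrow>\<^sub>E carrier_vec n)"
  unfolding bij_betw_def
proof
  let ?F = "\<lambda>h. \<lambda>j\<in>{..<m}. h *\<^sub>v unit_vec n (j * d)"
  show "inj_on ?F centralizer_mat"
  proof (rule inj_onI)
    fix h h' assume h: "h \<in> centralizer_mat" "h' \<in> centralizer_mat" and eq: "?F h = ?F h'"
    show "h = h'"
    proof (rule eq_matI_unit_vec[of _ n n])
      fix k assume k: "k < n"
      have j: "k div d < m" using k unfolding n_def by (metis less_mult_imp_div_less mult.commute)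
      have "h *\<^sub>v unit_vec n (k div d * d) = h' *\<^sub>v unit_vec n (k div d * d)"
        using fun_cong[OF eq, of "k div d"] j by simp
      then show "h *\<^sub>v unit_vec n k = h' *\<^sub>v unit_vec n k"
        using centralizer_determined[OF h(1) k] centralizer_determined[OF h(2) k] by simp
    qed (use h in \<open>simp_all add: centralizer_mat_def\<close>)
  qed
  show "?F ` centralizer_mat = {..<m} \<rightarrow>\<^sub>E carrier_vec n"
  proof (intro equalityI subsetI)
    fix W :: "nat \<Rightarrow> 'a vec" assume W: "W \<in> {..<m} \<rightarrow>\<^sub>E carrier_vec n"
    define V where "V = (\<lambda>j. if j < m then W j else 0\<^sub>v n)"
    have V: "V j \<in> carrier_vec n" for j using W by (auto simp: V_def)
    have FV: "?F (block_hom V) = W"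
    proof
      fix j show "?F (block_hom V) j = W j"
      proof (cases "j < m")
        case True
        then have "j * d < n" using index_bound[OF True d_pos] by simp
        then show ?thesis
          using True d_pos block_hom_unit[OF V] by (simp add: V_def)
      qed (use W in \<open>auto simp: PiE_def extensional_def\<close>)
    qed
    have "block_hom V \<in> centralizer_mat"
      using block_hom_comm[OF V] by (simp add: centralizer_mat_def)
    then show "W \<in> ?F ` centralizer_mat" by (rule image_eqI[where f = ?F and x = "block_hom V", OF FV[symmetric]])
  qed (auto simp: centralizer_mat_def intro!: mult_mat_vec_carrier)
qed

end

section \<open>Counting the centralizer\<close>

lemma bij_vec_lists: "bij_betw list_of_vec (carrier_vec n) {xs :: 'a list. length xs = n}"
  by (rule bij_betw_byWitness[where f' = vec_of_list]) (auto simp: vec_list list_vec intro: carrier_vecI)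

lemma card_carrier_vec: "card (carrier_vec n :: 'a::finite vec set) = CARD('a) ^ n"
  and finite_carrier_vec: "finite (carrier_vec n :: 'a::finite vec set)"
proof -
  note bij = bij_vec_lists[where 'a = 'a, of n]
  show "card (carrier_vec n :: 'a vec set) = CARD('a) ^ n"
    using bij_betw_same_card[OF bij] card_lists_length_eq[of "UNIV :: 'a set" n] by simp
  show "finite (carrier_vec n :: 'a vec set)"
    using bij_betw_finite[OF bij] finite_lists_length_eq[of "UNIV :: 'a set" n] by simp
qed

lemma matrix_inverse:
  fixes A :: "'a::field mat"
  assumes A: "A \<in> carrier_mat n n" and "det A \<noteq> 0"
  obtains B where "B \<in> carrier_mat n n" "A * B = 1\<^sub>m n" "B * A = 1\<^sub>m n"
  using det_non_zero_imp_unit[OF assms, where b = undefined] unfolding Units_def ring_mat_simps by auto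

lemma inverse_commute:
  fixes A B c c' :: "'a::field mat"
  assumes A: "A \<in> carrier_mat n n" and B: "B \<in> carrier_mat n n" and c: "c \<in> carrier_mat n n" "c' \<in> carrier_mat n n"
    and AB: "A * B = 1\<^sub>m n" "B * A = 1\<^sub>m n" and comm: "A * c = c' * A"
  shows "B * c' = c * B"
proof -
  have "B * c' = B * (c' * (A * B))" using B c AB by simp
  also have "\<dots> = B * (A * c * B)"
    using assoc_mult_mat[OF c(2) A B] comm by simp
  also have "\<dots> = (B * A) * (c * B)"
    using assoc_mult_mat[OF A c(1) B] assoc_mult_mat[OF B A mult_carrier_mat[OF c(1) B]] by simp
  also have "\<dots> = c * B" using AB left_mult_one_mat[OF mult_carrier_mat[OF c(1) B]] by simp
  finally show ?thesis .
qed

locale finite_block_companion = block_companion p m d n c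
  for p :: "'a::{field,finite} poly" and m d n :: nat and c :: "'a mat"
begin

lemma finite_centralizer: "finite centralizer_mat"
proof -
  have "finite ({..<m} \<rightarrow>\<^sub>E (carrier_vec n :: 'a vec set))"
    by (intro finite_PiE finite_carrier_vec) simp
  then show ?thesis using bij_betw_finite[OF centralizer_bij] by blast
qed

lemma card_centralizer: "card centralizer_mat = CARD('a) ^ (n * m)"
proof -
  have "card centralizer_mat = card ({..<m} \<rightarrow>\<^sub>E (carrier_vec n :: 'a vec set))"
    by (rule bij_betw_same_card[OF centralizer_bij])
  also have "\<dots> = (\<Prod>i<m. card (carrier_vec n :: 'a vec set))"
    by (rule card_PiE) simp
  also have "\<dots> = (CARD('a) ^ n) ^ m" unfolding card_carrier_vec by simp
  finally show ?thesis by (simp only: power_mult)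
qed

lemma centralizer_add:
  assumes "h \<in> centralizer_mat" "h' \<in> centralizer_mat"
  shows "h + h' \<in> centralizer_mat"
proof -
  have h: "h \<in> carrier_mat n n" "h' \<in> carrier_mat n n" "h * c = c * h" "h' * c = c * h'"
    using assms by (auto simp: centralizer_mat_def)
  have "(h + h') * c = c * (h + h')"
    unfolding add_mult_distrib_mat[OF h(1,2) c_carrier] mult_add_distrib_mat[OF c_carrier h(1,2)] h(3,4) ..
  then show ?thesis using h by (simp add: centralizer_mat_def)
qed

lemma centralizer_uminus:
  assumes "h \<in> centralizer_mat"
  shows "- h \<in> centralizer_mat"
proof -
  have h: "h \<in> carrier_mat n n" "h * c = c * h"
    using assms by (auto simp: centralizer_mat_def)
  have "- h * c = c * - h"
    using h(2) by (simp add: carrier_matD[OF h(1)] carrier_matD[OF c_carrier])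
  then show ?thesis using h by (simp add: centralizer_mat_def)
qed

text \<open>Evaluation at \<open>v\<close> is additive and, by transitivity, onto; its fibres are
  therefore translates of one another.\<close>

lemma card_centralizer_fiber:
  assumes v: "v \<in> carrier_vec n" "v \<noteq> 0\<^sub>v n"
  shows "card {h \<in> centralizer_mat. h *\<^sub>v v = 0\<^sub>v n} * CARD('a) ^ n = card centralizer_mat"
proof -
  define F where "F w = {h \<in> centralizer_mat. h *\<^sub>v v = w}" for w
  have card_F: "card (F w) = card (F (0\<^sub>v n))" if w: "w \<in> carrier_vec n" for w
  proof -
    obtain g where g: "g \<in> centralizer_mat" "g *\<^sub>v v = w"
      using centralizer_transitive[OF v w] .
    have gc: "g \<in> carrier_mat n n" using g(1) by (simp add: centralizer_mat_def)
    have "bij_betw (\<lambda>h. g + h) (F (0\<^sub>v n)) (F w)"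
    proof (rule bij_betw_byWitness[where f' = "\<lambda>h. - g + h"])
      show "\<forall>h\<in>F (0\<^sub>v n). - g + (g + h) = h" "\<forall>h\<in>F w. g + (- g + h) = h"
        using gc by (auto simp: F_def centralizer_mat_def intro!: eq_matI)
      show "(\<lambda>h. g + h) ` F (0\<^sub>v n) \<subseteq> F w"
      proof safe
        fix h assume h: "h \<in> F (0\<^sub>v n)"
        then have hc: "h \<in> carrier_mat n n" by (simp add: F_def centralizer_mat_def)
        show "g + h \<in> F w"
          using h g centralizer_add add_mult_distrib_mat_vec[OF gc hc v(1)] w by (simp add: F_def)
      qed
      show "(\<lambda>h. - g + h) ` F w \<subseteq> F (0\<^sub>v n)"
      proof safe
        fix h assume h: "h \<in> F w"
        then have hc: "h \<in> carrier_mat n n" by (simp add: F_def centralizer_mat_def)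
        have "- g *\<^sub>v v = - w" using gc v g by simp
        then show "- g + h \<in> F (0\<^sub>v n)"
          using h g centralizer_add centralizer_uminus add_mult_distrib_mat_vec[of "- g", OF _ hc v(1)] w gc
          by (simp add: F_def)
      qed
    qed
    then show ?thesis by (metis bij_betw_same_card)
  qed
  have "centralizer_mat = (\<Union>w\<in>carrier_vec n. F w)"
    using v(1) by (auto simp: F_def centralizer_mat_def intro!: mult_mat_vec_carrier)
  then have "card centralizer_mat = (\<Sum>w\<in>carrier_vec n. card (F w))"
    using finite_carrier_vec finite_centralizer
    by (simp only:) (subst card_UN_disjoint, auto simp: F_def)
  also have "\<dots> = (\<Sum>w\<in>(carrier_vec n :: 'a vec set). card (F (0\<^sub>v n)))"
    by (rule sum.cong[OF refl card_F])
  also have "\<dots> = CARD('a) ^ n * card (F (0\<^sub>v n))"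
    by (simp add: card_carrier_vec)
  finally show ?thesis by (simp add: F_def mult.commute)
qed

text \<open>The kernel of \<open>h\<close> is stable under \<open>c\<close>. With one nonzero
  \<open>v\<close> it contains every \<open>f(c) v\<close>, \<open>f \<noteq> 0\<close> of degree
  below \<open>d\<close>, and these are nonzero and distinct because \<open>p\<close> is
  irreducible.\<close>

lemma card_kernel_vectors:
  assumes h: "h \<in> centralizer_mat" "det h = 0"
  shows "CARD('a) ^ d - 1 \<le> card {v \<in> carrier_vec n - {0\<^sub>v n}. h *\<^sub>v v = 0\<^sub>v n}"
proof -
  have hc: "h \<in> carrier_mat n n" and comm: "h * c = c * h" using h by (simp_all add: centralizer_mat_def)
  obtain v where v: "v \<in> carrier_vec n" "v \<noteq> 0\<^sub>v n" "h *\<^sub>v v = 0\<^sub>v n"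
    using det_0_iff_vec_prod_zero[OF hc] h(2) by blast
  let ?P = "{f :: 'a poly. degree f < d \<or> f = 0}"
  have C: "poly_mat f c \<in> carrier_mat n n" for f by simp
  have nz: "poly_mat f c *\<^sub>v v \<noteq> 0\<^sub>v n" if "degree f < d" "f \<noteq> 0" for f
  proof
    assume "poly_mat f c *\<^sub>v v = 0\<^sub>v n"
    moreover have "\<not> p dvd f" using that dvd_imp_degree_le[of p f] by (auto simp: d_def)
    ultimately show False
      using poly_mat_irreducible_inj[OF c_carrier irr poly_mat_c _ v(1)] v(2) by blast
  qed
  have inj: "inj_on (\<lambda>f. poly_mat f c *\<^sub>v v) ?P"
  proof (rule inj_onI, rule ccontr)
    fix f g assume fg: "f \<in> ?P" "g \<in> ?P" "poly_mat f c *\<^sub>v v = poly_mat g c *\<^sub>v v" "f \<noteq> g"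
    have "degree (f - g) < d"
      using fg degree_diff_less[of f d g] d_pos by auto
    moreover have "poly_mat (f - g) c *\<^sub>v v = 0\<^sub>v n"
    proof -
      have "poly_mat f c *\<^sub>v v = poly_mat (f - g) c *\<^sub>v v + poly_mat g c *\<^sub>v v"
        using poly_mat_add[OF c_carrier, of "f - g" g] add_mult_distrib_mat_vec[OF C C v(1)] by simp
      then have eq: "poly_mat (f - g) c *\<^sub>v v + poly_mat g c *\<^sub>v v = poly_mat g c *\<^sub>v v" using fg(3) by simp
      have cv: "poly_mat f c *\<^sub>v v \<in> carrier_vec n" for f using C v(1) by (rule mult_mat_vec_carrier)
      have cancel: "a = 0\<^sub>v n" if "a + b = b" "a \<in> carrier_vec n" "b \<in> carrier_vec n" for a b :: "'a vec"
      proof (rule eq_vecI)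
        fix i assume "i < dim_vec (0\<^sub>v n)"
        then have i: "i < n" by simp
        have "a $ i + b $ i = b $ i" using that i by (metis index_add_vec(1) carrier_vecD)
        then show "a $ i = 0\<^sub>v n $ i" using i by simp
      qed (use that in auto)
      show ?thesis by (rule cancel[OF eq cv cv])
    qed
    ultimately show False using nz fg(4) by auto
  qed
  have sub: "(\<lambda>f. poly_mat f c *\<^sub>v v) ` (?P - {0}) \<subseteq> {v \<in> carrier_vec n - {0\<^sub>v n}. h *\<^sub>v v = 0\<^sub>v n}"
  proof safe
    fix f :: "'a poly" assume f: "degree f < d" "f \<noteq> 0"
    show "poly_mat f c *\<^sub>v v \<in> carrier_vec n" using C v(1) by (rule mult_mat_vec_carrier)
    show "poly_mat f c *\<^sub>v v = 0\<^sub>v n \<Longrightarrow> False" using nz[OF f] by blast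
    have "h *\<^sub>v (poly_mat f c *\<^sub>v v) = poly_mat f c *\<^sub>v (h *\<^sub>v v)"
      using poly_mat_comm[OF c_carrier hc comm c_carrier, of f]
        assoc_mult_mat_vec[OF hc C v(1), of f] assoc_mult_mat_vec[OF C hc v(1), of f] by simp
    then show "h *\<^sub>v (poly_mat f c *\<^sub>v v) = 0\<^sub>v n"
      using v(3) mult_mat_zero_vec[OF C] by simp
  qed
  have "CARD('a) ^ d - 1 = card (?P - {0})"
    using card_polys_degree_less[of d, where 'a = 'a] by simp
  also have "\<dots> = card ((\<lambda>f. poly_mat f c *\<^sub>v v) ` (?P - {0}))"
    by (rule card_image[symmetric], rule inj_on_subset[OF inj]) auto
  also have "\<dots> \<le> card {v \<in> carrier_vec n - {0\<^sub>v n}. h *\<^sub>v v = 0\<^sub>v n}"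
    by (rule card_mono[OF _ sub]) (simp add: finite_carrier_vec)
  finally show ?thesis .
qed

text \<open>Double counting of the pairs \<open>(h, v)\<close> with \<open>v \<noteq> 0\<close> and \<open>h v = 0\<close>.\<close>

lemma card_singular_centralizer:
  "(CARD('a) ^ d - 1) * card {h \<in> centralizer_mat. det h = 0} \<le> card centralizer_mat"
proof -
  let ?V = "carrier_vec n - {0\<^sub>v n} :: 'a vec set" and ?S = "{h \<in> centralizer_mat. det h = 0}"
  define q where "q = CARD('a)"
  have q: "q > 0" by (simp add: q_def)
  have fin: "finite ?V" "finite ?S" using finite_carrier_vec finite_centralizer by auto
  have "card ?S * (q ^ d - 1) = (\<Sum>h\<in>?S. q ^ d - 1)"
    by simp
  also have "\<dots> \<le> (\<Sum>h\<in>?S. card {v \<in> ?V. h *\<^sub>v v = 0\<^sub>v n})"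
    unfolding q_def by (intro sum_mono card_kernel_vectors) simp_all
  also have "\<dots> = (\<Sum>h\<in>?S. \<Sum>v\<in>?V. if h *\<^sub>v v = 0\<^sub>v n then 1 else 0)"
    using fin by (simp add: sum.If_cases Int_def)
  also have "\<dots> = (\<Sum>v\<in>?V. \<Sum>h\<in>?S. if h *\<^sub>v v = 0\<^sub>v n then 1 else 0)"
    by (rule sum.swap)
  also have "\<dots> \<le> (\<Sum>v\<in>?V. card {h \<in> centralizer_mat. h *\<^sub>v v = 0\<^sub>v n})"
  proof (rule sum_mono)
    fix v
    have "(\<Sum>h\<in>?S. if h *\<^sub>v v = 0\<^sub>v n then 1 else 0) = card {h \<in> ?S. h *\<^sub>v v = 0\<^sub>v n}"
      using fin by (simp add: sum.If_cases Int_def)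
    also have "\<dots> \<le> card {h \<in> centralizer_mat. h *\<^sub>v v = 0\<^sub>v n}"
      using finite_centralizer by (intro card_mono) auto
    finally show "(\<Sum>h\<in>?S. if h *\<^sub>v v = 0\<^sub>v n then 1 else 0) \<le> card {h \<in> centralizer_mat. h *\<^sub>v v = 0\<^sub>v n}" .
  qed
  finally have "card ?S * (q ^ d - 1) * q ^ n \<le> (\<Sum>v\<in>?V. card {h \<in> centralizer_mat. h *\<^sub>v v = 0\<^sub>v n}) * q ^ n"
    by (rule mult_le_mono1)
  also have "\<dots> = (\<Sum>v\<in>?V. card centralizer_mat)"
    unfolding sum_distrib_right q_def by (rule sum.cong) (auto simp: card_centralizer_fiber)
  also have "\<dots> \<le> q ^ n * card centralizer_mat"
  proof -
    have "card ?V \<le> q ^ n"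
      unfolding q_def card_carrier_vec[symmetric] using finite_carrier_vec by (intro card_mono) auto
    then show ?thesis by simp
  qed
  finally show ?thesis using q by (simp add: q_def mult.commute mult.assoc)
qed

text \<open>Multiplication by the inverse of a fixed element of determinant \<open>a\<close> injects
  the elements of determinant \<open>a\<close> into those of determinant 1.\<close>

lemma card_det1_centralizer:
  "card {h \<in> centralizer_mat. det h \<noteq> 0} \<le> (CARD('a) - 1) * card {h \<in> centralizer_mat. det h = 1}"
proof -
  define D where "D a = {h \<in> centralizer_mat. det h = a}" for a
  have fin: "finite (D a)" for a using finite_centralizer by (simp add: D_def)
  have le: "card (D a) \<le> card (D 1)" if a: "a \<noteq> 0" for a
  proof (cases "D a = {}")
    case False
    then obtain g where g: "g \<in> carrier_mat n n" "g * c = c * g" "det g = a"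
      by (auto simp: D_def centralizer_mat_def)
    obtain g' where g': "g' \<in> carrier_mat n n" "g * g' = 1\<^sub>m n" "g' * g = 1\<^sub>m n"
      using matrix_inverse[OF g(1)] g(3) a by blast
    have comm': "g' * c = c * g'"
      using inverse_commute[OF g(1) g'(1) c_carrier c_carrier g'(2,3) g(2)] .
    have detg': "det g' * a = 1"
      using det_mult[OF g'(1) g(1)] g'(3) g(3) by simp
    show ?thesis
    proof (rule card_inj_on_le[OF _ _ fin])
      show "inj_on (\<lambda>h. g' * h) (D a)"
      proof (rule inj_onI)
        fix x y assume "x \<in> D a" "y \<in> D a" and eq: "g' * x = g' * y"
        then have xy: "x \<in> carrier_mat n n" "y \<in> carrier_mat n n" by (auto simp: D_def centralizer_mat_def)
        have "g * (g' * x) = x" "g * (g' * y) = y"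
          using assoc_mult_mat[OF g(1) g'(1) xy(1)] assoc_mult_mat[OF g(1) g'(1) xy(2)] g' xy by simp_all
        then show "x = y" using eq by metis
      qed
      show "(\<lambda>h. g' * h) ` D a \<subseteq> D 1"
      proof safe
        fix h assume "h \<in> D a"
        then have h: "h \<in> carrier_mat n n" "h * c = c * h" "det h = a" by (auto simp: D_def centralizer_mat_def)
        have "g' * h * c = c * (g' * h)"
          using assoc_mult_mat[OF g'(1) h(1) c_carrier] assoc_mult_mat[OF g'(1) c_carrier h(1)]
            assoc_mult_mat[OF c_carrier g'(1) h(1)] h(2) comm' by simp
        then show "g' * h \<in> D 1"
          using h g' detg' det_mult[OF g'(1) h(1)] mult_carrier_mat[OF g'(1) h(1)]
          by (simp add: D_def centralizer_mat_def)
      qed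
    qed
  qed simp
  have "{h \<in> centralizer_mat. det h \<noteq> 0} = (\<Union>a\<in>UNIV - {0}. D a)"
    by (auto simp: D_def)
  then have "card {h \<in> centralizer_mat. det h \<noteq> 0} \<le> (\<Sum>a\<in>UNIV - {0}. card (D a))"
    by (simp only:) (rule card_UN_le, simp)
  also have "\<dots> \<le> (\<Sum>a\<in>UNIV - {0 :: 'a}. card (D 1))"
    using le by (intro sum_mono) auto
  also have "\<dots> = (CARD('a) - 1) * card (D 1)" by simp
  finally show ?thesis by (simp add: D_def)
qed

text \<open>At most a seventh of the centralizer is singular, and the rest splits into 7 determinant
  classes, none larger than that of 1. This gives the factor 49/6; 64 is the next power of 8,
  convenient for logarithms.\<close>

lemma card_det1_centralizer_ge:
  assumes "CARD('a) = 8"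
  shows "8 ^ (n * m) \<le> 64 * card {h \<in> centralizer_mat. det h = 1}"
proof -
  define r s t where "r = card centralizer_mat" and "s = card {h \<in> centralizer_mat. det h = 0}"
    and "t = card {h \<in> centralizer_mat. det h = 1}"
  have "{h \<in> centralizer_mat. det h \<noteq> 0} = centralizer_mat - {h \<in> centralizer_mat. det h = 0}" by auto
  then have "card {h \<in> centralizer_mat. det h \<noteq> 0} = r - s"
    using finite_centralizer by (simp add: card_Diff_subset r_def s_def)
  then have "r - s \<le> 7 * t"
    using card_det1_centralizer assms by (simp add: t_def)
  moreover have "7 * s \<le> r"
  proof -
    have "(8::nat) ^ 1 \<le> 8 ^ d" using d_pos by (intro power_increasing) auto
    then have "7 \<le> 8 ^ d - (1::nat)" by simp
    then have "7 * s \<le> (8 ^ d - 1) * s" by (rule mult_le_mono1)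
    also have "\<dots> \<le> r"
      using card_singular_centralizer unfolding assms r_def s_def .
    finally show ?thesis .
  qed
  ultimately have "r \<le> 64 * t" by linarith
  then show ?thesis using card_centralizer assms by (simp add: r_def t_def)
qed

end

section \<open>Conjugacy classes and supports\<close>

lemma conj_class_image: "conj_class G x = (\<lambda>h. h \<otimes>\<^bsub>G\<^esub> x \<otimes>\<^bsub>G\<^esub> inv\<^bsub>G\<^esub> h) ` carrier G"
  by (auto simp: conj_class_def)

lemma (in group) conj_eq_iff:
  assumes "h \<in> carrier G" "x \<in> carrier G" "y \<in> carrier G"
  shows "h \<otimes> x \<otimes> inv h = y \<longleftrightarrow> h \<otimes> x = y \<otimes> h"
  using assms by (metis inv_solve_right' m_closed)

text \<open>Orbit-stabilizer for conjugation: each fibre of \<open>h \<mapsto> h x h^-1\<close> is a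
  left coset of the centralizer of \<open>x\<close>.\<close>

lemma (in group) card_conj_class_mult_centralizer:
  assumes fin: "finite (carrier G)" and x: "x \<in> carrier G"
  shows "card (conj_class G x) * card {h \<in> carrier G. h \<otimes> x = x \<otimes> h} = card (carrier G)"
proof -
  let ?f = "\<lambda>h. h \<otimes> x \<otimes> inv h" and ?C = "{h \<in> carrier G. h \<otimes> x = x \<otimes> h}"
  have fiber: "card {h \<in> carrier G. ?f h = y} = card ?C" if y: "y \<in> ?f ` carrier G" for y
  proof -
    obtain g where g: "g \<in> carrier G" and yg: "y = ?f g" using y by blast
    have yc: "y \<in> carrier G" using g x yg by simp
    have gx: "g \<otimes> x = y \<otimes> g" using conj_eq_iff[OF g x yc] yg by simp
    have "y = g \<otimes> (x \<otimes> inv g)" using g x by (simp add: yg m_assoc)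
    then have gi: "inv g \<otimes> y = x \<otimes> inv g"
      using g x yc inv_solve_left[of "x \<otimes> inv g" g y] by simp
    have "bij_betw (\<lambda>h. g \<otimes> h) ?C {h \<in> carrier G. ?f h = y}"
    proof (rule bij_betw_byWitness[where f' = "\<lambda>h. inv g \<otimes> h"])
      show "(\<lambda>h. g \<otimes> h) ` ?C \<subseteq> {h \<in> carrier G. ?f h = y}"
      proof safe
        fix h assume h: "h \<in> carrier G" "h \<otimes> x = x \<otimes> h"
        have "g \<otimes> h \<otimes> x = y \<otimes> (g \<otimes> h)"
          using g h x yc gx by (metis m_assoc)
        then show "?f (g \<otimes> h) = y"
          using conj_eq_iff[of "g \<otimes> h" x y] g h x yc by simp
      qed (use g in auto)
      show "(\<lambda>h. inv g \<otimes> h) ` {h \<in> carrier G. ?f h = y} \<subseteq> ?C"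
      proof safe
        fix h assume h: "h \<in> carrier G" and "y = ?f h"
        then have hx: "h \<otimes> x = y \<otimes> h" using conj_eq_iff[OF h x yc] by simp
        have "inv g \<otimes> h \<otimes> x = inv g \<otimes> (y \<otimes> h)"
          using g h x hx by (simp add: m_assoc)
        also have "\<dots> = (inv g \<otimes> y) \<otimes> h" using g h yc by (simp add: m_assoc)
        also have "\<dots> = x \<otimes> (inv g \<otimes> h)" unfolding gi using g h x by (simp add: m_assoc)
        finally show "inv g \<otimes> h \<otimes> x = x \<otimes> (inv g \<otimes> h)" .
      qed (use g in auto)
    qed (use g in \<open>auto simp: m_assoc[symmetric]\<close>)
    then show ?thesis by (rule bij_betw_same_card[THEN sym])
  qed
  have "card (carrier G) = (\<Sum>h\<in>carrier G. 1)" by simp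
  also have "\<dots> = (\<Sum>y\<in>?f ` carrier G. \<Sum>h\<in>{h \<in> carrier G. ?f h = y}. 1)"
    by (rule sum.image_gen[OF fin])
  also have "\<dots> = (\<Sum>y\<in>?f ` carrier G. card {h \<in> carrier G. ?f h = y})"
    by (simp only: card_eq_sum)
  also have "\<dots> = (\<Sum>y\<in>?f ` carrier G. card ?C)"
    by (rule sum.cong[OF refl fiber])
  finally show ?thesis by (simp add: conj_class_image)
qed

text \<open>Inversion commutes with conjugation, so reality need only be checked at one
  representative.\<close>

lemma (in group) conj_class_real:
  assumes x: "x \<in> carrier G" and inv: "inv x \<in> conj_class G x"
  shows "conj_class G x = set_inv (conj_class G x)"
proof -
  let ?S = "conj_class G x"
  have S: "?S \<subseteq> carrier G" using x by (auto simp: conj_class_def)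
  obtain g where g: "g \<in> carrier G" "inv x = g \<otimes> x \<otimes> inv g"
    using inv by (auto simp: conj_class_def)
  have closed: "inv y \<in> ?S" if y: "y \<in> ?S" for y
  proof -
    obtain h where h: "h \<in> carrier G" "y = h \<otimes> x \<otimes> inv h"
      using y by (auto simp: conj_class_def)
    have "inv y = h \<otimes> inv x \<otimes> inv h"
      using h x by (simp add: inv_mult_group m_assoc)
    also have "\<dots> = (h \<otimes> g) \<otimes> x \<otimes> inv (h \<otimes> g)"
      using h g x by (simp add: inv_mult_group m_assoc)
    finally show ?thesis using h g by (auto simp: conj_class_def)
  qed
  show ?thesis
  proof (intro equalityI subsetI)
    fix y assume y: "y \<in> ?S"
    then have "y = inv (inv y)" using S by auto
    then show "y \<in> set_inv ?S" using closed[OF y] unfolding SET_INV_def by blast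
  qed (auto simp: SET_INV_def closed)
qed

section \<open>Comparing \<open>b\<close> with a product of \<open>b\<close> and a diagonal
  matrix\<close>

lemma krylov_pow:
  assumes A: "A \<in> carrier_mat n n" and v: "v \<in> carrier_vec n"
  shows "krylov A i v = (A ^\<^sub>m i) *\<^sub>v v"
  using v
proof (induction i arbitrary: v)
  case 0
  then show ?case using A by simp
next
  case (Suc i)
  then show ?case
    using A assoc_mult_mat_vec[OF pow_carrier_mat[OF A] A Suc.prems, of i]
    by (simp add: krylov_Suc_right)
qed

text \<open>A dimension count: \<open>s * d\<close> linear conditions on \<open>n\<close>
  coordinates. They put \<open>b v, ..., b^d v\<close> into the subspace where a diagonal matrix
  that is constant from index \<open>s\<close> on acts as a scalar.\<close>

lemma exists_krylov_vanishing:
  fixes b :: "'a::field mat"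
  assumes b: "b \<in> carrier_mat n n" and sd: "s * d < n" and d: "d > 0"
  obtains v where "v \<in> carrier_vec n" "v \<noteq> 0\<^sub>v n"
    "\<And>r j. r < s \<Longrightarrow> j < d \<Longrightarrow> krylov b (Suc j) v $ r = 0"
proof -
  \<comment> \<open>The rows of \<open>M\<close> are the \<open>s * d < n\<close> linear conditions on \<open>v\<close>, padded with zero rows.\<close>
  define M where "M = mat n n (\<lambda>(k, l). if k < s * d then (b ^\<^sub>m Suc (k mod d)) $$ (k div d, l) else 0)"
  have M: "M \<in> carrier_mat n n" by (simp add: M_def)
  \<comment> \<open>Since \<open>s * d \<le> n - 1\<close>, the last row of \<open>M\<close> is a
    padding row, so \<open>M\<close> is singular.\<close>
  have "M\<^sup>T *\<^sub>v unit_vec n (n - 1) = 0\<^sub>v n"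
  proof (rule eq_vecI)
    fix i assume "i < dim_vec (0\<^sub>v n)"
    then show "(M\<^sup>T *\<^sub>v unit_vec n (n - 1)) $ i = 0\<^sub>v n $ i"
      using sd by (simp add: M_def scalar_prod_right_unit[of _ n])
  qed (simp add: M_def)
  moreover have "unit_vec n (n - 1) \<noteq> (0\<^sub>v n :: 'a vec)"
    using sd by (simp add: unit_vec_nonzero)
  ultimately have "det (M\<^sup>T) = 0"
    using det_0_iff_vec_prod_zero[of "M\<^sup>T" n] M by (metis transpose_carrier_mat unit_vec_carrier)
  then have "det M = 0" using det_transpose[OF M] by simp
  then obtain v where v: "v \<in> carrier_vec n" "v \<noteq> 0\<^sub>v n" "M *\<^sub>v v = 0\<^sub>v n"
    using det_0_iff_vec_prod_zero[OF M] by blast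
  have "krylov b (Suc j) v $ r = 0" if rj: "r < s" "j < d" for r j
  proof -
    \<comment> \<open>Row \<open>r * d + j\<close> encodes coordinate \<open>r\<close> of
      \<open>b^(j + 1) v\<close>; the exponent starts at 1, since the diagonal matrix is only ever
      applied after \<open>b\<close>.\<close>
    define k where "k = r * d + j"
    have "k < Suc r * d" using rj by (simp add: k_def)
    also have "\<dots> \<le> s * d" using rj by (intro mult_le_mono1) simp
    finally have k: "k < s * d" "k < n" using sd by auto
    have kd: "k div d = r" "k mod d = j" using rj by (simp_all add: k_def)
    have r: "r < n"
    proof -
      have "r \<le> r * d" using d by simp
      then show ?thesis using k(2) unfolding k_def by linarith
    qed
    have "row M k = row (b ^\<^sub>m Suc j) r"
    proof (rule eq_vecI)
      fix i assume "i < dim_vec (row (b ^\<^sub>m Suc j) r)"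
      then have i: "i < n" using b by simp
      have "M $$ (k, i) = (b ^\<^sub>m Suc j) $$ (r, i)"
        using k i by (simp only: M_def index_mat(1) case_prod_conv kd if_True)
      then show "row M k $ i = row (b ^\<^sub>m Suc j) r $ i"
        using k r i carrier_matD[OF M] carrier_matD[OF pow_carrier_mat[OF b, of "Suc j"]]
        by (simp only: index_row)
    qed (use carrier_matD[OF M] carrier_matD[OF pow_carrier_mat[OF b, of "Suc j"]] in \<open>simp only: index_row\<close>)
    then have "krylov b (Suc j) v $ r = (M *\<^sub>v v) $ k"
      unfolding krylov_pow[OF b v(1)]
      using carrier_matD[OF M] carrier_matD[OF pow_carrier_mat[OF b, of "Suc j"]] r k by simp
    then show ?thesis using v(3) k by simp
  qed
  then show ?thesis using that v by blast
qed

text \<open>Along the vector \<open>v\<close> above, the iterates of \<open>a = x * b\<close> are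
  those of \<open>b\<close> scaled by powers of \<open>\<mu>\<close>. If \<open>p(a) = 0\<close>,
  then \<open>f(T) = p(\<mu> T)\<close> kills \<open>v\<close> under \<open>b\<close>; but
  \<open>p\<close> does not divide \<open>f\<close>, so \<open>f(b)\<close> is injective.\<close>

lemma diag_mult_not_both_annihilated:
  fixes p :: "'a::field poly" and y :: "nat \<Rightarrow> 'a"
  assumes irr: "irreducible p" and d: "degree p = d" and p0: "coeff p 0 \<noteq> 0" and mu: "\<mu> ^ d \<noteq> 1"
    and b: "b \<in> carrier_mat n n" "poly_mat p b = 0\<^sub>m n n"
    and x: "x = mat n n (\<lambda>(i, j). if i = j then y i else 0)" and y: "\<And>i. s \<le> i \<Longrightarrow> i < n \<Longrightarrow> y i = \<mu>"
    and sd: "s * d < n"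
  shows "poly_mat p (x * b) \<noteq> 0\<^sub>m n n"
proof
  define a where "a = x * b"
  assume "poly_mat p (x * b) = 0\<^sub>m n n"
  then have pa: "poly_mat p a = 0\<^sub>m n n" by (simp add: a_def)
  have xc: "x \<in> carrier_mat n n" by (simp add: x)
  have a: "a \<in> carrier_mat n n" unfolding a_def using xc b(1) by (rule mult_carrier_mat)
  have d0: "d > 0" using mu by (cases d) auto
  obtain v where v: "v \<in> carrier_vec n" "v \<noteq> 0\<^sub>v n"
    and vz: "\<And>r j. r < s \<Longrightarrow> j < d \<Longrightarrow> krylov b (Suc j) v $ r = 0"
    using exists_krylov_vanishing[OF b(1) sd d0] by metis
  have x_eigen: "x *\<^sub>v w = \<mu> \<cdot>\<^sub>v w" if w: "w \<in> carrier_vec n" "\<And>r. r < s \<Longrightarrow> w $ r = 0" for w :: "'a vec"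
  proof (rule eq_vecI)
    fix r assume "r < dim_vec (\<mu> \<cdot>\<^sub>v w)"
    then have r: "r < n" using w by simp
    have "(x *\<^sub>v w) $ r = (\<Sum>l<n. (if r = l then y r else 0) * w $ l)"
      using r w(1) by (simp add: x scalar_prod_def lessThan_atLeast0)
    also have "\<dots> = (\<Sum>l<n. if l = r then y r * w $ r else 0)"
      by (rule sum.cong) auto
    also have "\<dots> = \<mu> * w $ r" using r w(2)[of r] y[of r] by (cases "r < s") auto
    finally show "(x *\<^sub>v w) $ r = (\<mu> \<cdot>\<^sub>v w) $ r" using r w by simp
  qed (use w xc in simp)
  have kry: "krylov a j v = \<mu> ^ j \<cdot>\<^sub>v krylov b j v" if "j \<le> d" for j
    using that
  proof (induction j)
    case (Suc j)
    have kb: "krylov b i v \<in> carrier_vec n" for i using b(1) v(1) by simp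
    have "krylov a (Suc j) v = \<mu> ^ j \<cdot>\<^sub>v (a *\<^sub>v krylov b j v)"
      using Suc mult_mat_vec[OF a kb] by (simp add: krylov_Suc)
    also have "a *\<^sub>v krylov b j v = x *\<^sub>v krylov b (Suc j) v"
      unfolding a_def krylov_Suc by (rule assoc_mult_mat_vec[OF xc b(1) kb])
    also have "\<dots> = \<mu> \<cdot>\<^sub>v krylov b (Suc j) v"
      using Suc.prems by (intro x_eigen kb vz) auto
    finally show ?case by (simp add: smult_smult_assoc mult.commute)
  qed simp
  define f where "f = pcompose p [:0, \<mu>:]"
  have coeff_f: "coeff f i = \<mu> ^ i * coeff p i" for i
    unfolding f_def by (simp add: coeff_pcompose_linear)
  have degf: "degree f \<le> d"
    using d by (intro degree_le) (auto simp: coeff_f coeff_eq_0)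
  \<comment> \<open>By degrees a cofactor would be a constant \<open>u\<close>. Constant
    coefficients give \<open>u = 1\<close>, leading ones \<open>u = \<mu> ^ d\<close>.\<close>
  have "\<not> p dvd f"
  proof
    assume "p dvd f"
    then obtain g where g: "f = p * g" by (elim dvdE)
    have "f \<noteq> 0" using coeff_f[of 0] p0 by auto
    then have "degree g = 0"
      using degf d g by (metis add_le_same_cancel1 degree_mult_eq le_zero_eq mult_zero_left mult_zero_right)
    then obtain u where "g = [:u:]" by (elim degree_eq_zeroE)
    then have fu: "f = smult u p" using g by simp
    have "coeff p d \<noteq> 0" using irr d by auto
    moreover have "\<mu> ^ d * coeff p d = u * coeff p d"
      using coeff_f[of d] fu by auto
    moreover have "coeff p 0 = u * coeff p 0"
      using coeff_f[of 0] fu by simp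
    ultimately show False using p0 mu by simp
  qed
  moreover have "poly_mat f b *\<^sub>v v = 0\<^sub>v n"
  proof (rule eq_vecI)
    fix r assume "r < dim_vec (0\<^sub>v n)"
    then have r: "r < n" by simp
    have "(poly_mat f b *\<^sub>v v) $ r = (\<Sum>i<Suc d. coeff f i * krylov b i v $ r)"
      using degf by (intro poly_mat_mult_vec_nth[OF b(1) r v(1)]) simp
    also have "\<dots> = (\<Sum>i<Suc d. coeff p i * krylov a i v $ r)"
    proof (rule sum.cong[OF refl])
      fix i assume "i \<in> {..<Suc d}"
      then have "krylov a i v $ r = \<mu> ^ i * krylov b i v $ r"
        using kry[of i] r carrier_vecD[OF krylov_carrier[OF b(1) v(1), of i]] by simp
      then show "coeff f i * krylov b i v $ r = coeff p i * krylov a i v $ r"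
        by (simp add: coeff_f)
    qed
    also have "\<dots> = (poly_mat p a *\<^sub>v v) $ r"
      using d by (intro poly_mat_mult_vec_nth[OF a r v(1), symmetric]) simp
    finally show "(poly_mat f b *\<^sub>v v) $ r = 0\<^sub>v n $ r"
      using r v(1) by (simp add: pa zero_mat_mult_vec)
  qed (use carrier_matD[OF poly_mat_carrier[OF b(1)]] in simp)
  ultimately have "v = 0\<^sub>v n"
    by (intro poly_mat_irreducible_inj[OF b(1) irr b(2) _ v(1)])
  then show False using v(2) by blast
qed

section \<open>Supports of diagonal matrices\<close>

text \<open>The nonzero columns live on different coordinates, hence are independent; any further
  column is zero, so they form a maximal independent set of columns.\<close>

lemma (in vec_space) rank_diag:
  assumes A: "A = mat n n (\<lambda>(i, j). if i = j then y i else 0)"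
  shows "rank A = card {i. i < n \<and> y i \<noteq> 0}"
proof -
  have Ac: "A \<in> carrier_mat n n" by (simp add: A)
  define I where "I = {i. i < n \<and> y i \<noteq> 0}"
  define S where "S = col A ` I"
  have colA: "col A i $ r = (if r = i then y i else 0)" "col A i \<in> carrier_vec n" if "i < n" "r < n" for i r
    using that by (auto simp: A)
  have inj: "inj_on (col A) I"
  proof (rule inj_onI)
    fix i j assume ij: "i \<in> I" "j \<in> I" "col A i = col A j"
    then have "col A j $ i \<noteq> 0" using colA(1)[of i i] by (auto simp: I_def)
    then show "i = j" using colA(1)[of j i] ij by (auto simp: I_def split: if_splits)
  qed
  have Scols: "S \<subseteq> set (cols A)" using Ac by (auto simp: S_def I_def cols_def)
  have Scar: "S \<subseteq> carrier_vec n" using Scols cols_dim[of A] Ac by auto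
  have finS: "finite S" by (simp add: S_def I_def)
  have indpt: "lin_indpt S"
  proof
    assume "lin_dep S"
    then obtain a w where aw: "lincomb a S = 0\<^sub>v n" "w \<in> S" "a w \<noteq> 0"
      using finite_lin_dep[OF finS _ Scar] by auto
    obtain i where i: "i \<in> I" "w = col A i" using aw by (auto simp: S_def)
    have "0 = lincomb a S $ i" using aw i by (simp add: I_def)
    also have "\<dots> = (\<Sum>u\<in>S. a u * u $ i)"
      using i Scar by (intro lincomb_index) (auto simp: I_def)
    also have "\<dots> = (\<Sum>j\<in>I. a (col A j) * col A j $ i)"
      unfolding S_def by (simp add: sum.reindex[OF inj])
    also have "\<dots> = (\<Sum>j\<in>I. if j = i then a w * y i else 0)"
      using i colA(1) by (intro sum.cong) (auto simp: I_def)
    also have "\<dots> = a w * y i" using i by (simp add: I_def)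
    finally show False using aw i by (simp add: I_def)
  qed
  have "maximal S (\<lambda>T. T \<subseteq> set (cols A) \<and> lin_indpt T)"
    unfolding maximal_def
  proof (intro conjI allI impI)
    fix B assume SB: "S \<subseteq> B \<and> B \<subseteq> set (cols A) \<and> lin_indpt B"
    then have B: "S \<subseteq> B" and Bp: "B \<subseteq> set (cols A) \<and> lin_indpt B" by auto
    have "B \<subseteq> S"
    proof
      fix w assume w: "w \<in> B"
      then obtain i where i: "i < n" "w = col A i" using Bp Ac by (auto simp: cols_def)
      have "w \<noteq> 0\<^sub>v n"
      proof
        assume w0: "w = 0\<^sub>v n"
        have "B \<subseteq> carrier_vec n" using Bp cols_dim[of A] Ac by auto
        then show False using vs_zero_lin_dep[of B] Bp w w0 by auto
      qed
      have "y i \<noteq> 0"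
      proof
        assume "y i = 0"
        then have "w = 0\<^sub>v n" using i by (intro eq_vecI) (auto simp: A)
        then show False using \<open>w \<noteq> 0\<^sub>v n\<close> by blast
      qed
      then show "w \<in> S" using i by (auto simp: S_def I_def)
    qed
    then show "B = S" using B by blast
  qed (use Scols indpt in auto)
  then have "rank A = card S" by (rule rank_card_indpt[OF Ac])
  also have "\<dots> = card I" unfolding S_def by (rule card_image[OF inj])
  finally show ?thesis by (simp add: I_def)
qed

text \<open>Subtracting \<open>l\<close> leaves as rank the number of diagonal entries different
  from \<open>l\<close>. For \<open>l = \<mu>\<close> this is \<open>s\<close>; for any other
  \<open>l\<close> it is at least \<open>n - s\<close>, which \<open>2 * s \<le> n\<close> makes at
  least \<open>s\<close>.\<close>

lemma supp_diag:
  fixes y :: "nat \<Rightarrow> 'a::field"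
  assumes x: "x = mat n n (\<lambda>(i, j). if i = j then y i else 0)"
    and y: "\<And>i. s \<le> i \<Longrightarrow> i < n \<Longrightarrow> y i = \<mu>" "\<And>i. i < s \<Longrightarrow> y i \<noteq> \<mu>"
    and mu: "\<mu> \<noteq> 0" and s: "2 * s \<le> n"
  shows "supp x = s"
proof -
  have rank: "vec_space.rank (dim_row x) (map_mat to_ac x - l \<cdot>\<^sub>m 1\<^sub>m (dim_row x))
      = card {i. i < n \<and> to_ac (y i) \<noteq> l}" for l
  proof -
    have "map_mat to_ac x - l \<cdot>\<^sub>m 1\<^sub>m n = mat n n (\<lambda>(i, j). if i = j then to_ac (y i) - l else 0)"
      by (rule eq_matI) (auto simp: x)
    from vec_space.rank_diag[OF this] show ?thesis by (simp add: x)
  qed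
  have "{i. i < n \<and> to_ac (y i) \<noteq> to_ac \<mu>} = {..<s}"
    using y s by (auto simp: not_less) (metis not_le)
  then have at: "card {i. i < n \<and> to_ac (y i) \<noteq> to_ac \<mu>} = s" by simp
  have ge: "s \<le> card {i. i < n \<and> to_ac (y i) \<noteq> l}" for l
  proof (cases "l = to_ac \<mu>")
    case False
    then have "{s..<n} \<subseteq> {i. i < n \<and> to_ac (y i) \<noteq> l}" using y(1) by auto
    then have "card {s..<n} \<le> card {i. i < n \<and> to_ac (y i) \<noteq> l}"
      by (intro card_mono) auto
    then show ?thesis using s by simp
  qed (use at in simp)
  show ?thesis
    unfolding supp_def rank
  proof (rule cInf_eq_minimum)
    show "s \<in> (\<lambda>l. card {i. i < n \<and> to_ac (y i) \<noteq> l}) ` (- {0})"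
      using at mu by (intro image_eqI[of _ _ "to_ac \<mu>"]) auto
  qed (use ge in auto)
qed

section \<open>The main theorem\<close>

text \<open>In each block, \<open>T \<mapsto> T\<^sup>-\<^sup>1\<close> on \<open>F[T]/(p)\<close> followed by multiplication with \<open>T\<^sup>d\<^sup>-\<^sup>1\<close> reverses the basis
  of monomials.\<close>

definition block_reversal :: "nat \<Rightarrow> nat \<Rightarrow> 'a::comm_ring_1 mat" where
  "block_reversal d n = mat n n (\<lambda>(r, k). if r div d = k div d \<and> r mod d + k mod d = d - 1 then 1 else 0)"

lemma block_reversal_carrier [simp]: "block_reversal d n \<in> carrier_mat n n"
  by (simp add: block_reversal_def)

lemma sum_single_block:
  fixes g :: "nat \<Rightarrow> 'b::comm_monoid_add"
  assumes "d > 0" "j < m" and "\<And>k. k < d * m \<Longrightarrow> k div d \<noteq> j \<Longrightarrow> g k = 0"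
  shows "(\<Sum>k<d * m. g k) = (\<Sum>i<d. g (j * d + i))"
proof -
  have "(\<Sum>k<d * m. g k) = (\<Sum>k<d * m. if k div d = j then g k else 0)"
    using assms(3) by (intro sum.cong) auto
  then show ?thesis using sum_block[OF assms(1,2)] by simp
qed

lemma mult_mat_nth_sum:
  assumes "A \<in> carrier_mat n n" "B \<in> carrier_mat n n" "r < n" "k < n"
  shows "(A * B) $$ (r, k) = (\<Sum>l<n. A $$ (r, l) * B $$ (l, k))"
  using assms by (simp add: scalar_prod_def lessThan_atLeast0)

lemma block_reversal_mult_nth:
  fixes B :: "'a::comm_ring_1 mat"
  assumes d: "d > 0" and n: "n = d * m" and B: "B \<in> carrier_mat n n" and rk: "r < n" "k < n"
  shows "(block_reversal d n * B) $$ (r, k) = B $$ (r div d * d + (d - 1 - r mod d), k)"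
proof -
  have j: "r div d < m" using rk unfolding n by (metis less_mult_imp_div_less mult.commute)
  let ?J = "block_reversal d n :: 'a mat"
  have bound: "r div d * d + i < n" if "i < d" for i
  proof -
    have "r div d * d + i < Suc (r div d) * d" using that by simp
    also have "\<dots> \<le> m * d" using j by (intro mult_le_mono1) simp
    finally show ?thesis by (simp add: n mult.commute)
  qed
  have "(?J * B) $$ (r, k) = (\<Sum>l<d * m. ?J $$ (r, l) * B $$ (l, k))"
    using mult_mat_nth_sum[OF block_reversal_carrier B rk] unfolding n .
  also have "\<dots> = (\<Sum>i<d. ?J $$ (r, r div d * d + i) * B $$ (r div d * d + i, k))"
    by (rule sum_single_block[OF d j]) (use rk in \<open>auto simp: block_reversal_def n\<close>)
  also have "\<dots> = (\<Sum>i<d. if i = d - 1 - r mod d then B $$ (r div d * d + i, k) else 0)"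
  proof (rule sum.cong[OF refl])
    fix i assume i: "i \<in> {..<d}"
    have "r mod d < d" using d by simp
    then have "r mod d + i = d - 1 \<longleftrightarrow> i = d - 1 - r mod d" by linarith
    then show "?J $$ (r, r div d * d + i) * B $$ (r div d * d + i, k)
        = (if i = d - 1 - r mod d then B $$ (r div d * d + i, k) else 0)"
      using rk i bound[of i] by (simp add: block_reversal_def)
  qed
  also have "\<dots> = B $$ (r div d * d + (d - 1 - r mod d), k)"
    using d by simp
  finally show ?thesis .
qed

lemma block_reversal_square:
  assumes d: "d > 0" and n: "n = d * m"
  shows "block_reversal d n * block_reversal d n = (1\<^sub>m n :: 'a::comm_ring_1 mat)"
proof (rule eq_matI)
  fix r k assume "r < dim_row (1\<^sub>m n :: 'a mat)" "k < dim_col (1\<^sub>m n :: 'a mat)"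
  then have rk: "r < n" "k < n" by simp_all
  define s where "s = r div d * d + (d - 1 - r mod d)"
  have sd: "s div d = r div d" "s mod d = d - 1 - r mod d"
    using d by (simp_all add: s_def)
  have j: "r div d < m" using rk unfolding n by (metis less_mult_imp_div_less mult.commute)
  have "s < Suc (r div d) * d" using d by (simp add: s_def)
  also have "\<dots> \<le> m * d" using j by (intro mult_le_mono1) simp
  finally have s: "s < n" by (simp add: n mult.commute)
  have mods: "r mod d < d" "k mod d < d" using d by simp_all
  have "(block_reversal d n * block_reversal d n :: 'a mat) $$ (r, k) = block_reversal d n $$ (s, k)"
    unfolding s_def by (rule block_reversal_mult_nth[OF d n block_reversal_carrier rk])
  also have "\<dots> = (if r div d = k div d \<and> r mod d = k mod d then 1 else 0)"
  proof -
    have "d - 1 - r mod d + k mod d = d - 1 \<longleftrightarrow> r mod d = k mod d" using mods by linarith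
    then show ?thesis using s rk by (simp add: block_reversal_def sd)
  qed
  also have "r div d = k div d \<and> r mod d = k mod d \<longleftrightarrow> r = k"
    by (metis div_mult_mod_eq)
  finally show "(block_reversal d n * block_reversal d n :: 'a mat) $$ (r, k) = 1\<^sub>m n $$ (r, k)"
    using rk by simp
qed (simp_all add: block_reversal_def)

context block_companion
begin

text \<open>Written as \<open>c J c = J\<close> to keep inverses out of the entry computation; as
  \<open>J^2 = 1\<close>, it says that \<open>J\<close> conjugates \<open>c\<close> to its
  inverse.\<close>

lemma reversal_conjugates:
  assumes palin: "reflect_poly p = p"
  shows "c * (block_reversal d n * c) = block_reversal d n"
proof (rule eq_matI)
  let ?J = "block_reversal d n :: 'a mat"
  have JC: "?J * c \<in> carrier_mat n n" by (rule mult_carrier_mat[OF block_reversal_carrier c_carrier])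
  have p_sym: "coeff p (d - i) = coeff p i" if "i \<le> d" for i
    using that coeff_reflect_poly[of p i] by (simp add: palin d_def)
  have p0: "coeff p 0 = 1" using p_sym[of 0] monic by (simp add: d_def)
  fix r k assume "r < dim_row ?J" "k < dim_col ?J"
  then have rk: "r < n" "k < n" by (simp_all add: block_reversal_def)
  have j: "r div d < m" using rk unfolding n_def by (metis less_mult_imp_div_less mult.commute)
  define t where "t = r mod d"
  define i where "i = k mod d"
  have ti: "t < d" "i < d" using d_pos by (simp_all add: t_def i_def)
  obtain e where e: "d = Suc e" using d_pos by (cases d) auto
  have c_nth: "c $$ (r div d * d + a, k) = (if r div d = k div d then
      (if i = d - 1 then - coeff p a else if a = i + 1 then 1 else 0) else 0)" if "a < d" for a
    using that index_bound[OF j that] rk by (simp add: c_eq i_def)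
  have JC_nth: "(?J * c) $$ (r div d * d + a, k) = c $$ (r div d * d + (d - 1 - a), k)" if "a < d" for a
    using block_reversal_mult_nth[OF d_pos n_def c_carrier index_bound[OF j that] rk(2)] that by simp
  have c_row: "c $$ (r, r div d * d + a) = (if a = d - 1 then - coeff p t else if t = a + 1 then 1 else 0)"
    if "a < d" for a
    using that index_bound[OF j that] rk by (simp add: c_eq t_def)
  \<comment> \<open>\<open>G a\<close> is the term of inner index \<open>a\<close> in the block of
    \<open>r\<close>. Only two can be nonzero: \<open>a = d - 1\<close>, from the last column of
    \<open>c\<close>, and \<open>a = t - 1\<close>, from its subdiagonal.\<close>
  define G where "G a = (if a = d - 1 then - coeff p t else if t = a + 1 then 1 else 0)
      * c $$ (r div d * d + (d - 1 - a), k)" for a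
  have "(c * (?J * c)) $$ (r, k) = (\<Sum>l<d * m. c $$ (r, l) * (?J * c) $$ (l, k))"
    using mult_mat_nth_sum[OF c_carrier JC rk] unfolding n_def .
  also have "\<dots> = (\<Sum>a<d. c $$ (r, r div d * d + a) * (?J * c) $$ (r div d * d + a, k))"
    by (rule sum_single_block[OF d_pos j]) (use rk in \<open>auto simp: c_eq n_def\<close>)
  also have "\<dots> = (\<Sum>a<d. G a)"
    by (rule sum.cong[OF refl]) (simp only: c_row JC_nth lessThan_iff G_def)
  also have "\<dots> = (\<Sum>a<e. G a) + G e"
    by (simp add: e)
  also have "(\<Sum>a<e. G a) = (\<Sum>a<e. (if t = a + 1 then 1 else 0) * c $$ (r div d * d + (e - a), k))"
    by (rule sum.cong) (auto simp: G_def e)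
  also have "G e = - (coeff p t * c $$ (r div d * d, k))"
    by (simp add: G_def e)
  also have "(\<Sum>a<e. (if t = a + 1 then 1 else 0) * c $$ (r div d * d + (e - a), k))
      = (\<Sum>a<e. if a = t - 1 then if t > 0 then c $$ (r div d * d + (d - t), k) else 0 else 0)"
    by (rule sum.cong) (auto simp: e)
  also have "\<dots> = (if t > 0 then c $$ (r div d * d + (d - t), k) else 0)"
    using ti e by (cases t) auto
  also have "\<dots> + - (coeff p t * c $$ (r div d * d, k)) = ?J $$ (r, k)"
  proof (cases "r div d = k div d")
    case False
    then show ?thesis
      using rk ti c_nth[of "d - t"] c_nth[of 0] d_pos by (simp add: block_reversal_def)
  next
    case True
    have J: "?J $$ (r, k) = (if t + i = d - 1 then 1 else 0)"
      using rk True by (simp add: block_reversal_def t_def i_def)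
    have c0: "c $$ (r div d * d, k) = (if i = d - 1 then - 1 else 0)"
      using c_nth[of 0] True d_pos p0 by simp
    show ?thesis
    proof (cases "t = 0")
      case True
      then show ?thesis using J c0 p0 by simp
    next
      case t: False
      \<comment> \<open>If \<open>i = d - 1\<close>, the two terms are \<open>- coeff p t\<close>
        and \<open>coeff p t\<close> by the symmetry of \<open>p\<close>, and cancel. Otherwise only
        the subdiagonal entry of \<open>c\<close> is left, which sits where \<open>J\<close> has its
        ones.\<close>
      have "c $$ (r div d * d + (d - t), k) = (if i = d - 1 then - coeff p t else if d - t = i + 1 then 1 else 0)"
        using c_nth[of "d - t"] True t ti p_sym[of t] by simp
      moreover have "d - t = i + 1 \<longleftrightarrow> t + i = d - 1" using ti by linarith
      ultimately show ?thesis using J c0 t ti by auto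
    qed
  qed
  finally show "(c * (?J * c)) $$ (r, k) = ?J $$ (r, k)" .
qed (use carrier_matD[OF c_carrier] in \<open>simp_all add: block_reversal_def\<close>)

end

lemma square_eq_1_char2:
  assumes "CHAR('a::idom) = 2" "(a::'a) * a = 1"
  shows "a = 1"
  using assms by (metis square_eq_1_iff uminus_char2)

section \<open>The logarithmic estimate\<close>

text \<open>The factor 64 costs \<open>2 * L\<close> in logarithms, so \<open>x\<close> and
  \<open>d y\<close> fall short of \<open>n^2 L\<close> by at most \<open>2 * L\<close> and
  \<open>2 * d * L\<close>, and differ by at most \<open>2 * d * L\<close>. Dividing by
  \<open>d x\<close>, with \<open>x \<ge> n^2 L / 2\<close>, yields the constant 4.\<close>

lemma ln_ratio_bound:
  fixes g cc sz d m n :: nat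
  assumes sz: "sz * cc = g" and g: "8 ^ (n * n) \<le> 64 * g" "g \<le> 8 ^ (n * n)"
    and cc: "8 ^ (n * m) \<le> 64 * cc" "cc \<le> 8 ^ (n * m)" and n: "n = d * m" and dm: "d \<ge> 2" "m \<ge> 1"
  shows "\<bar>ln (real sz) / ln (real g) - (1 - 1 / real d)\<bar> \<le> 4 * real n powi (-2)"
proof -
  define L where "L = ln (8::real)"
  have L: "L > 0" by (simp add: L_def)
  have L64: "ln (64::real) = 2 * L"
    using ln_realpow[of "8::real" 2] by (simp add: L_def)
  have pos: "g > 0" "cc > 0"
    using g(1) cc(1) by (auto intro!: Nat.gr0I)
  have sz0: "sz > 0" using sz pos by (cases sz) auto
  have log_pow: "ln (real (8 ^ k)) = real k * L" for k
    by (simp add: L_def ln_realpow)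
  have up: "ln (real a) \<le> real k * L" if "a \<le> 8 ^ k" "a > 0" for a k
  proof -
    have "ln (real a) \<le> ln (real (8 ^ k))"
      using that by (subst ln_le_cancel_iff) (auto simp flip: of_nat_le_iff)
    then show ?thesis unfolding log_pow .
  qed
  have low: "real k * L - 2 * L \<le> ln (real a)" if "8 ^ k \<le> 64 * a" "a > 0" for a k
  proof -
    have "real (8 ^ k) \<le> real (64 * a)"
      using that(1) by (simp only: of_nat_le_iff)
    then have "ln (real (8 ^ k)) \<le> ln (real (64 * a))"
      using that(2) by (subst ln_le_cancel_iff) simp_all
    also have "\<dots> = 2 * L + ln (real a)"
      using that(2) by (simp add: ln_mult L64)
    finally show ?thesis unfolding log_pow by simp
  qed
  define x y where "x = ln (real g)" and "y = ln (real cc)"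
  have x: "real n * real n * L - 2 * L \<le> x" "x \<le> real n * real n * L"
    using low[OF g(1) pos(1)] up[OF g(2) pos(1)] by (simp_all add: x_def)
  have y: "real n * real m * L - 2 * L \<le> y" "y \<le> real n * real m * L"
    using low[OF cc(1) pos(2)] up[OF cc(2) pos(2)] by (simp_all add: y_def)
  have szl: "ln (real sz) = x - y"
    unfolding x_def y_def sz[symmetric] using sz0 pos by (simp add: ln_mult)
  have n2: "real n \<ge> 2"
  proof -
    have "2 * 1 \<le> d * m" using dm by (intro mult_le_mono) auto
    then show ?thesis unfolding n by linarith
  qed
  then have nn: "real n * real n \<ge> 4" using mult_mono[of 2 "real n" 2 "real n"] by simp
  \<comment> \<open>From \<open>n \<ge> 2\<close>, the loss \<open>2 * L\<close> is at most half of
    \<open>n^2 L\<close>.\<close>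
  have x_ge: "real n * real n * L / 2 \<le> x"
  proof -
    have "2 * L \<le> real n * real n * L / 2" using nn L by (simp add: field_simps mult_right_mono)
    then show ?thesis using x(1) by linarith
  qed
  have x0: "x > 0" using x_ge nn L by (smt (verit) divide_pos_pos mult_pos_pos)
  have d0: "real d > 0" using dm by simp
  have nd: "real n * real m * real d = real n * real n" by (simp add: n)
  have dnm: "real d * (real n * real m * L) = real n * real n * L"
    unfolding nd[symmetric] by (simp only: mult_ac)
  have "real d * y \<le> real n * real n * L"
    using mult_left_mono[OF y(2), of "real d"] d0 unfolding dnm by simp
  moreover have "real n * real n * L - 2 * real d * L \<le> real d * y"
    using mult_left_mono[OF y(1), of "real d"] d0 by (simp add: right_diff_distrib dnm)
  moreover have "2 * L \<le> 2 * real d * L" using dm L by simp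
  ultimately have "\<bar>x - real d * y\<bar> \<le> 2 * real d * L"
    using x by linarith
  then have "\<bar>x - real d * y\<bar> / (real d * x) \<le> 2 * real d * L / (real d * x)"
    using x0 d0 by (intro divide_right_mono) auto
  also have "\<dots> = 2 * L / x" using d0 by simp
  also have "\<dots> \<le> 2 * L / (real n * real n * L / 2)"
    using x_ge x0 L nn by (intro divide_left_mono) auto
  also have "\<dots> = 4 * real n powi (-2)"
    using L n2 by (simp add: field_simps power_int_minus power2_eq_square)
  finally have main: "\<bar>x - real d * y\<bar> / (real d * x) \<le> 4 * real n powi (-2)" .
  have "(x - y) / x - (1 - 1 / real d) = (x - real d * y) / (real d * x)"
    using x0 d0 by (simp add: field_simps)
  then have "\<bar>ln (real sz) / ln (real g) - (1 - 1 / real d)\<bar> = \<bar>x - real d * y\<bar> / (real d * x)"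
    using x0 d0 by (simp add: szl x_def abs_divide abs_mult)
  then show ?thesis using main by simp
qed


section \<open>The order of \<open>SL n\<close>\<close>

context
  fixes n :: nat
  assumes F8: "card (UNIV :: 'a::{field,finite} set) = 8"
begin

text \<open>For \<open>p = T - 1\<close>, with \<open>n\<close> blocks of size 1, \<open>c\<close>
  is the identity and the centralizer consists of all matrices. The count of centralizing matrices
  of determinant 1 then becomes a bound for the order of \<open>SL n\<close>.\<close>

interpretation one: finite_block_companion "[:- 1, 1 :: 'a:]" n 1 n "diag_block_mat (replicate n (companion_mat [:- 1, 1 :: 'a:]))"
  by unfold_locales (simp_all add: irreducible_linear_field_poly)

lemma centralizer_one: "one.centralizer_mat = carrier_mat n n"
proof -
  have "diag_block_mat (replicate n (companion_mat [:- 1, 1 :: 'a:])) = 1\<^sub>m n"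
    by (subst one.c_eq) (auto intro!: eq_matI)
  then show ?thesis unfolding one.centralizer_mat_def by auto
qed

lemma card_SL:
  "8 ^ (n * n) \<le> 64 * card (carrier (SL n :: 'a mat monoid))"
  "card (carrier (SL n :: 'a mat monoid)) \<le> 8 ^ (n * n)"
  "finite (carrier (SL n :: 'a mat monoid))"
proof -
  have eq: "carrier (SL n :: 'a mat monoid) = {h \<in> one.centralizer_mat. det h = 1}"
    by (simp add: centralizer_one)
  show "8 ^ (n * n) \<le> 64 * card (carrier (SL n :: 'a mat monoid))"
    unfolding eq by (rule one.card_det1_centralizer_ge[OF F8])
  show "finite (carrier (SL n :: 'a mat monoid))"
    unfolding eq using one.finite_centralizer by simp
  have "card (carrier (SL n :: 'a mat monoid)) \<le> card one.centralizer_mat"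
    unfolding eq using one.finite_centralizer by (intro card_mono) auto
  then show "card (carrier (SL n :: 'a mat monoid)) \<le> 8 ^ (n * n)"
    using one.card_centralizer F8 by simp
qed

end

section \<open>Annihilating polynomials of conjugates\<close>

lemma SL_inv_mult:
  assumes "h \<in> carrier (SL n :: 'a::field mat monoid)"
  shows "inv\<^bsub>SL n\<^esub> h \<in> carrier_mat n n" "inv\<^bsub>SL n\<^esub> h * h = 1\<^sub>m n" "h * inv\<^bsub>SL n\<^esub> h = 1\<^sub>m n"
proof -
  interpret G: group "SL n :: 'a mat monoid" by (rule group_SL)
  show "inv\<^bsub>SL n\<^esub> h \<in> carrier_mat n n" using G.inv_closed[OF assms] by simp
  show "inv\<^bsub>SL n\<^esub> h * h = 1\<^sub>m n" using G.l_inv[OF assms] by simp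
  show "h * inv\<^bsub>SL n\<^esub> h = 1\<^sub>m n" using G.r_inv[OF assms] by simp
qed

lemma poly_mat_conj_class:
  fixes c :: "'a::field mat"
  assumes c: "c \<in> carrier_mat n n" "poly_mat p c = 0\<^sub>m n n" and a: "a \<in> conj_class (SL n) c"
  shows "a \<in> carrier_mat n n" "poly_mat p a = 0\<^sub>m n n"
proof -
  obtain h where h: "h \<in> carrier (SL n)" and ah: "a = h * c * inv\<^bsub>SL n\<^esub> h"
    using a by (auto simp: conj_class_def)
  have hc: "h \<in> carrier_mat n n" using h by simp
  note hi = SL_inv_mult[OF h]
  have hcc: "h * c \<in> carrier_mat n n" using hc c(1) by (rule mult_carrier_mat)
  show ac: "a \<in> carrier_mat n n" unfolding ah using hcc hi(1) by (rule mult_carrier_mat)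
  have "a * h = h * c * (inv\<^bsub>SL n\<^esub> h * h)"
    unfolding ah by (rule assoc_mult_mat[OF hcc hi(1) hc])
  then have "h * c = a * h" using hi(2) right_mult_one_mat[OF hcc] by simp
  then have "h * poly_mat p c = poly_mat p a * h"
    by (rule poly_mat_comm[OF c(1) hc _ ac])
  then have "poly_mat p a * h = 0\<^sub>m n n"
    using c(2) right_mult_zero_mat[OF hc] by simp
  then have "poly_mat p a * (h * inv\<^bsub>SL n\<^esub> h) = 0\<^sub>m n n"
    using assoc_mult_mat[OF poly_mat_carrier[OF ac] hc hi(1)] left_mult_zero_mat[OF hi(1)] by metis
  then show "poly_mat p a = 0\<^sub>m n n"
    using hi(3) right_mult_one_mat[OF poly_mat_carrier[OF ac]] by simp
qed

section \<open>The diagonal elements to be avoided\<close>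

text \<open>The unit group has order 7, which is prime to \<open>d\<close>; so
  \<open>\<mu> ^ d = 1\<close> would force \<open>\<mu> = 1\<close>, and any element besides 0 and 1
  will do.\<close>

lemma exists_power_neq_1:
  assumes F8: "card (UNIV :: 'a::{field,finite} set) = 8" and d: "\<not> 7 dvd d"
  obtains \<mu> :: "'a::{field,finite}" where "\<mu> \<noteq> 0" "\<mu> \<noteq> 1" "\<mu> ^ d \<noteq> 1"
proof -
  have "\<not> (UNIV :: 'a set) \<subseteq> {0, 1}"
    using card_mono[of "{0, 1 :: 'a}" UNIV] F8 by auto
  then obtain \<mu> :: 'a where mu: "\<mu> \<noteq> 0" "\<mu> \<noteq> 1" by blast
  have "\<mu> * \<mu> ^ 7 = \<mu>"
    using finite_field_power_CARD[of \<mu>] F8 by (simp flip: power_Suc)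
  then have mu7: "\<mu> ^ 7 = 1" using mu(1) by simp
  have "\<mu> ^ d \<noteq> 1"
  proof
    assume mud: "\<mu> ^ d = 1"
    have "prime (7::nat)" by simp
    then have "gcd d 7 = 1"
      using d by (metis coprime_iff_gcd_eq_1 prime_imp_coprime gcd.commute)
    moreover have "d \<noteq> 0" using d by (cases d) auto
    ultimately obtain x y where "d * x = 7 * y + 1"
      using bezout_nat[of d 7] by auto
    then have "(\<mu> ^ d) ^ x = (\<mu> ^ 7) ^ y * \<mu>"
      by (metis power_mult power_add power_one_right)
    then show False using mud mu7 mu(2) by simp
  qed
  then show ?thesis using that mu by blast
qed

text \<open>The first two entries, \<open>z\<close> and \<open>\<kappa> / z\<close>, correct the
  determinant, whence \<open>s \<ge> 2\<close>; the others below \<open>s\<close> are 1. For both to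
  be nonzero and different from \<open>\<mu>\<close>, \<open>z\<close> has to avoid three values,
  fewer than the 8 available.\<close>

lemma exists_det1_diag:
  fixes \<mu> :: "'a::{field,finite}"
  assumes F8: "card (UNIV :: 'a set) = 8" and mu: "\<mu> \<noteq> 0" "\<mu> \<noteq> 1" and s: "2 \<le> s" "s \<le> n"
  shows "\<exists>y. (\<forall>i\<ge>s. y i = \<mu>) \<and> (\<forall>i<s. y i \<noteq> \<mu>) \<and>
    det (mat n n (\<lambda>(i, j). if i = j then y i else 0)) = 1"
proof -
  \<comment> \<open>The product required of the first \<open>s\<close> entries, given that the
    remaining ones contribute \<open>\<mu> ^ (n - s)\<close>.\<close>
  define \<kappa> where "\<kappa> = inverse (\<mu> ^ (n - s))"
  have "card {0, \<mu>, \<kappa> / \<mu>} \<le> 3" by (simp add: card_insert_if)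
  then have "\<not> (UNIV :: 'a set) \<subseteq> {0, \<mu>, \<kappa> / \<mu>}"
    using card_mono[of "{0, \<mu>, \<kappa> / \<mu>}" UNIV] F8 by auto
  then obtain z where z: "z \<noteq> 0" "z \<noteq> \<mu>" "z \<noteq> \<kappa> / \<mu>" by blast
  define y where "y i = (if i = 0 then z else if i = 1 then \<kappa> / z else if i < s then 1 else \<mu>)" for i :: nat
  have k0: "\<kappa> \<noteq> 0" using mu by (simp add: \<kappa>_def)
  have "\<kappa> / z \<noteq> \<mu>" using z mu by (auto simp: field_simps)
  then have low: "y i \<noteq> \<mu>" if "i < s" for i using z mu that by (simp add: y_def)
  have high: "y i = \<mu>" if "s \<le> i" for i using s that by (simp add: y_def)
  define A where "A = mat n n (\<lambda>(i, j). if i = j then y i else 0)"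
  have "upper_triangular A" by (auto simp: A_def)
  then have "det A = prod_list (diag_mat A)"
    by (rule det_upper_triangular[of A n]) (simp add: A_def)
  also have "diag_mat A = map y [0..<n]"
    by (auto simp: diag_mat_def A_def)
  also have "prod_list \<dots> = (\<Prod>i<n. y i)"
    by (simp add: prod.list_conv_set_nth lessThan_atLeast0)
  also have "{..<n} = {..<s} \<union> {s..<n}" using s by auto
  also have "(\<Prod>i\<in>\<dots>. y i) = (\<Prod>i<s. y i) * (\<Prod>i=s..<n. y i)"
    by (rule prod.union_disjoint) auto
  also have "(\<Prod>i=s..<n. y i) = \<mu> ^ (n - s)" using high by simp
  also have "(\<Prod>i<s. y i) = \<kappa>"
  proof -
    have "{..<s} = {0, 1} \<union> {2..<s}" using s by auto
    then have "(\<Prod>i<s. y i) = (\<Prod>i\<in>{0, 1}. y i) * (\<Prod>i=2..<s. y i)"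
      by (simp only:) (rule prod.union_disjoint, auto)
    also have "(\<Prod>i=2..<s. y i) = 1" by (rule prod.neutral) (auto simp: y_def)
    finally show ?thesis using z by (simp add: y_def)
  qed
  finally have "det A = 1" using mu by (simp add: \<kappa>_def)
  then show ?thesis using high low unfolding A_def by blast
qed


theorem theorem1p4:
  assumes F8: "card (UNIV :: 'a :: {field, finite} set) = 8"
  shows "\<exists>K :: real. K > 0 \<and>
    (\<forall>d m n :: nat. d \<ge> 4 \<longrightarrow> even d \<longrightarrow> m \<ge> 3 \<longrightarrow> \<not> 7 dvd d * m \<longrightarrow> n = d * m \<longrightarrow>
      (\<exists>p :: 'a poly. lead_coeff p = 1 \<and> irreducible p \<and> degree p = d \<and>
        (let G = SL n :: 'a mat monoid;
             c = diag_block_mat (replicate m (companion_mat p));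
             S = conj_class G c
         in c \<in> carrier G \<and>
            S = set_inv\<^bsub>G\<^esub> S \<and>
            \<bar>ln (real (card S)) / ln (real (card (carrier G))) - (1 - 1 / real d)\<bar>
              \<le> K * real n powi (-2) \<and>
            (\<forall>s :: nat. 2 \<le> s \<longrightarrow> s < m \<longrightarrow>
              (\<exists>x \<in> carrier G. supp x = s \<and> x \<notin> S <#>\<^bsub>G\<^esub> (set_inv\<^bsub>G\<^esub> S))))))"
proof (intro exI[of _ "4 :: real"] conjI allI impI)
  fix d m n :: nat
  assume d: "d \<ge> 4" "even d" and m: "m \<ge> 3" and 7: "\<not> 7 dvd d * m" and n: "n = d * m"
  obtain p :: "'a poly" where p: "lead_coeff p = 1" "irreducible p" "degree p = d" "reflect_poly p = p"
    using exists_palindromic_irreducible[OF F8 d(2)] d(1) by force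
  define G where "G = (SL n :: 'a mat monoid)"
  define c where "c = diag_block_mat (replicate m (companion_mat p))"
  define S where "S = conj_class G c"
  interpret G: group G unfolding G_def by (rule group_SL)
  interpret fb: finite_block_companion p m d n c
    by unfold_locales (simp_all add: p(2,3) p(1)[unfolded p(3)] n c_def)
  have char: "CHAR('a) = 2" by (rule CHAR_card8[OF F8])
  define J where "J = (block_reversal d n :: 'a mat)"
  have J: "J \<in> carrier_mat n n" by (simp add: J_def)
  have JJ: "J * J = 1\<^sub>m n"
    unfolding J_def by (rule block_reversal_square[OF fb.d_pos n])
  have JC: "J * c \<in> carrier_mat n n" using J fb.c_carrier by (rule mult_carrier_mat)
  have cJc: "c * (J * c) = J" unfolding J_def by (rule fb.reversal_conjugates[OF p(4)])
  \<comment> \<open>In characteristic 2 the only square root of 1 is 1. So \<open>J^2 = 1\<close>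
    gives \<open>det J = 1\<close>, and \<open>c J c = J\<close> then gives
    \<open>det c = 1\<close>, without expanding either determinant.\<close>
  have "det J * det J = 1"
    using det_mult[OF J J] JJ by simp
  then have detJ: "det J = 1" by (rule square_eq_1_char2[OF char])
  have "det c * (det J * det c) = det J"
    using det_mult[OF fb.c_carrier JC] det_mult[OF J fb.c_carrier] cJc by simp
  then have "det c * det c = 1" unfolding detJ by simp
  then have detc: "det c = 1" by (rule square_eq_1_char2[OF char])
  have cG: "c \<in> carrier G" and JG: "J \<in> carrier G"
    using J detJ detc by (simp_all add: G_def)
  have real: "S = set_inv\<^bsub>G\<^esub> S"
    unfolding S_def
  proof (rule G.conj_class_real[OF cG])
    have "J \<otimes>\<^bsub>G\<^esub> J = \<one>\<^bsub>G\<^esub>" using JJ by (simp add: G_def)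
    then have invJ: "inv\<^bsub>G\<^esub> J = J" using G.inv_equality[OF _ JG JG] by simp
    have "J * c * J * c = 1\<^sub>m n"
      using assoc_mult_mat[OF JC J fb.c_carrier] assoc_mult_mat[OF J fb.c_carrier JC] cJc JJ by simp
    then have "J \<otimes>\<^bsub>G\<^esub> c \<otimes>\<^bsub>G\<^esub> J \<otimes>\<^bsub>G\<^esub> c = \<one>\<^bsub>G\<^esub>" by (simp add: G_def)
    then have "inv\<^bsub>G\<^esub> c = J \<otimes>\<^bsub>G\<^esub> c \<otimes>\<^bsub>G\<^esub> J"
      using cG JG by (intro G.inv_equality) (simp_all only: G.m_closed)
    then show "inv\<^bsub>G\<^esub> c \<in> conj_class G c"
      using JG by (auto simp: conj_class_def invJ intro!: exI[of _ J])
  qed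
  \<comment> \<open>The constant 4 chosen for \<open>K\<close> is that of
    \<open>ln_ratio_bound\<close>, applied with the centralizer of \<open>c\<close> in
    \<open>G\<close>, the part of determinant 1 of the full commuting algebra.\<close>
  have bound: "\<bar>ln (real (card S)) / ln (real (card (carrier G))) - (1 - 1 / real d)\<bar> \<le> 4 * real n powi (-2)"
  proof (rule ln_ratio_bound)
    let ?C = "{h \<in> fb.centralizer_mat. det h = 1}"
    have C: "{h \<in> carrier G. h \<otimes>\<^bsub>G\<^esub> c = c \<otimes>\<^bsub>G\<^esub> h} = ?C"
      by (auto simp: G_def fb.centralizer_mat_def)
    show "card S * card ?C = card (carrier G)"
      using G.card_conj_class_mult_centralizer[OF _ cG] card_SL(3)[OF F8] unfolding C S_def
      by (simp add: G_def)
    show "8 ^ (n * n) \<le> 64 * card (carrier G)" "card (carrier G) \<le> 8 ^ (n * n)"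
      unfolding G_def by (rule card_SL[OF F8])+
    show "8 ^ (n * m) \<le> 64 * card ?C" by (rule fb.card_det1_centralizer_ge[OF F8])
    have "card ?C \<le> card fb.centralizer_mat"
      using fb.finite_centralizer by (intro card_mono) auto
    then show "card ?C \<le> 8 ^ (n * m)" using fb.card_centralizer F8 by simp
  qed (use d m n in auto)
  have avoid: "\<exists>x\<in>carrier G. supp x = s \<and> x \<notin> S <#>\<^bsub>G\<^esub> set_inv\<^bsub>G\<^esub> S" if s: "2 \<le> s" "s < m" for s
  proof -
    have "\<not> 7 dvd d" using 7 by (meson dvd_mult2)
    then obtain \<mu> :: 'a where mu: "\<mu> \<noteq> 0" "\<mu> \<noteq> 1" "\<mu> ^ d \<noteq> 1"
      using exists_power_neq_1[OF F8] by blast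
    \<comment> \<open>Here \<open>s < m\<close> enters, as the dimension count behind the common
      vector \<open>v\<close>.\<close>
    have sd: "s * d < n" using s d unfolding n by (simp add: mult.commute)
    have "2 * s \<le> d * m" using s d by (intro mult_le_mono) auto
    then have s2: "2 * s \<le> n" by (simp add: n)
    then have sn: "s \<le> n" by simp
    obtain y :: "nat \<Rightarrow> 'a" where y: "\<And>i. s \<le> i \<Longrightarrow> y i = \<mu>" "\<And>i. i < s \<Longrightarrow> y i \<noteq> \<mu>"
      "det (mat n n (\<lambda>(i, j). if i = j then y i else 0)) = 1"
      using exists_det1_diag[OF F8 mu(1,2) s(1) sn] by blast
    define x where "x = mat n n (\<lambda>(i, j). if i = j then y i else 0)"
    have xG: "x \<in> carrier G" using y(3) by (simp add: G_def x_def)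
    have "supp x = s"
      by (rule supp_diag[OF x_def y(1,2) mu(1) s2])
    moreover have "x \<notin> S <#>\<^bsub>G\<^esub> set_inv\<^bsub>G\<^esub> S"
    proof
      assume "x \<in> S <#>\<^bsub>G\<^esub> set_inv\<^bsub>G\<^esub> S"
      then obtain a b where ab: "a \<in> S" "b \<in> S" "x = a \<otimes>\<^bsub>G\<^esub> inv\<^bsub>G\<^esub> b"
        by (auto simp: set_mult_def SET_INV_def)
      have SG: "S \<subseteq> carrier G" using cG by (auto simp: S_def conj_class_def)
      then have "a = x \<otimes>\<^bsub>G\<^esub> b"
        using ab(1,2) by (simp add: ab(3) G.m_assoc subsetD)
      then have axb: "a = x * b" by (simp add: G_def)
      \<comment> \<open>All elements of \<open>S\<close> are annihilated by \<open>p\<close>, in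
        particular both \<open>b\<close> and \<open>x * b = a\<close>, which the diagonal shape of
        \<open>x\<close> forbids.\<close>
      note S' = poly_mat_conj_class[OF fb.c_carrier fb.poly_mat_c, folded G_def, folded S_def]
      have "coeff p 0 \<noteq> 0"
        using p by (metis coeff_0_reflect_poly one_neq_zero)
      from diag_mult_not_both_annihilated[OF p(2,3) this mu(3) S'[OF ab(2)] x_def y(1) sd]
      show False using S'(2)[OF ab(1)] axb by simp
    qed
    ultimately show ?thesis using xG by blast
  qed
  show "\<exists>p :: 'a poly. lead_coeff p = 1 \<and> irreducible p \<and> degree p = d \<and>
        (let G = SL n :: 'a mat monoid;
             c = diag_block_mat (replicate m (companion_mat p));
             S = conj_class G c
         in c \<in> carrier G \<and>
            S = set_inv\<^bsub>G\<^esub> S \<and>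
            \<bar>ln (real (card S)) / ln (real (card (carrier G))) - (1 - 1 / real d)\<bar>
              \<le> 4 * real n powi (-2) \<and>
            (\<forall>s :: nat. 2 \<le> s \<longrightarrow> s < m \<longrightarrow>
              (\<exists>x \<in> carrier G. supp x = s \<and> x \<notin> S <#>\<^bsub>G\<^esub> (set_inv\<^bsub>G\<^esub> S))))"
    by (rule exI[of _ p], unfold Let_def, fold G_def c_def, fold S_def,
        intro conjI allI impI p(1-3) cG real bound avoid)
qed simp

end
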